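(* Let $1\le p<\infty$, let $u$ be an analytic function on the open unit disk $\mathbb{D}$ and $\varphi$ an analytic self-map of $\mathbb{D}$ such that the weighted composition operator $uC_\varphi: H^p\to\mathcal{B}$ is bounded. Then $$\|uC_\varphi\|_{e,H^p\to\mathcal{B}}\approx\max\Big\{\limsup_{|a|\to1}\|uC_\varphi(p_a)\|_{\mathcal{B}},\ \limsup_{|a|\to1}\|uC_\varphi(q_a)\|_{\mathcal{B}}\Big\}$$ $$\approx\max\Big\{\limsup_{|\varphi(z)|\to1}\frac{(1-|z|^2)|u'(z)|}{(1-|\varphi(z)|^2)^{1/p}},\ \limsup_{|\varphi(z)|\to1}\frac{(1-|z|^2)|u(z)\varphi'(z)|}{(1-|\varphi(z)|^2)^{(1+p)/p}}\Big\},$$ where, for $a,z\in\mathbb{D}$, $$p_a(z)=\frac{(1-|a|^2)^{2-1/p}}{(1-\overline{a}z)^2},\qquad q_a(z)=\frac{(1-|a|^2)^2}{(1-\overline{a}z)^{2+1/p}}.$$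
   Context: $H(\mathbb{D})$ is the space of analytic functions on the open unit disk $\mathbb{D}\subset\mathbb{C}$. For $u\in H(\mathbb{D})$ and an analytic $\varphi:\mathbb{D}\to\mathbb{D}$, the weighted composition operator is $(uC_\varphi f)(z)=u(z)f(\varphi(z))$, $f\in H(\mathbb{D})$. The Hardy space $H^p$ consists of all $f\in H(\mathbb{D})$ with $\|f\|_{H^p}^p=\sup_{0<r<1}\frac{1}{2\pi}\int_0^{2\pi}|f(re^{i\theta})|^p\,d\theta<\infty$. The Bloch space $\mathcal{B}$ consists of all $f\in H(\mathbb{D})$ with $\sup_{z\in\mathbb{D}}(1-|z|^2)|f'(z)|<\infty$, with norm $\|f\|_{\mathcal{B}}=|f(0)|+\sup_{z\in\mathbb{D}}(1-|z|^2)|f'(z)|$. The essential norm of a bounded linear operator $T:X\to Y$ between Banach spaces is $\|T\|_{e,X\to Y}=\inf\{\|T-K\|_{X\to Y}: K:X\to Y \text{ compact}\}$. $\limsup_{|\varphi(z)|\to1}F(z)$ means $\lim_{s\to1^-}\sup\{F(z): z\in\mathbb{D},\ |\varphi(z)|>s\}$, with the supremum over the empty set taken as $0$. $X\approx Y$ means $C^{-1}Y\le X\le CY$ for a constant $C>0$ depending only on $p$. *)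

theory Defs
  imports "HOL-Complex_Analysis.Complex_Analysis"
begin

abbreviation unit_disk :: "complex set" ("\<D>") where
  "\<D> \<equiv> ball 0 1"

text \<open>
  HOL functions are total, so an analytic function on the disk is represented by its extension by
  0 to the whole plane.  With this normal form, functions that agree on the disk are equal, and
  the spaces below are normed (rather than only seminormed) under pointwise operations.
\<close>

definition analytic_disk :: "(complex \<Rightarrow> complex) set" where
  "analytic_disk = {f. f holomorphic_on \<D> \<and> (\<forall>z. z \<notin> \<D> \<longrightarrow> f z = 0)}"

definition on_disk :: "(complex \<Rightarrow> complex) \<Rightarrow> complex \<Rightarrow> complex" where
  "on_disk f = (\<lambda>z. if z \<in> \<D> then f z else 0)"

definition weighted_comp ::
    "(complex \<Rightarrow> complex) \<Rightarrow> (complex \<Rightarrow> complex) \<Rightarrow> (complex \<Rightarrow> complex) \<Rightarrow> complex \<Rightarrow> complex" where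
  "weighted_comp u \<phi> f = on_disk (\<lambda>z. u z * f (\<phi> z))"

definition hardy_mean :: "real \<Rightarrow> (complex \<Rightarrow> complex) \<Rightarrow> real \<Rightarrow> real" where
  "hardy_mean p f r =
     1 / (2 * pi) * integral {0..2 * pi} (\<lambda>\<theta>. cmod (f (of_real r * exp (\<i> * of_real \<theta>))) powr p)"

definition Hardy :: "real \<Rightarrow> (complex \<Rightarrow> complex) set" where
  "Hardy p = {f \<in> analytic_disk. bdd_above (hardy_mean p f ` {0<..<1})}"

definition hardy_norm :: "real \<Rightarrow> (complex \<Rightarrow> complex) \<Rightarrow> real" where
  "hardy_norm p f = (SUP r\<in>{0<..<1}. hardy_mean p f r) powr (1 / p)"

definition Bloch :: "(complex \<Rightarrow> complex) set" where
  "Bloch = {f \<in> analytic_disk. bdd_above ((\<lambda>z. (1 - (cmod z)\<^sup>2) * cmod (deriv f z)) ` \<D>)}"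

definition bloch_norm :: "(complex \<Rightarrow> complex) \<Rightarrow> real" where
  "bloch_norm f = cmod (f 0) + (SUP z\<in>\<D>. (1 - (cmod z)\<^sup>2) * cmod (deriv f z))"

text \<open>
  A normed space is given by its carrier \<open>X\<close>, a set of functions with pointwise operations, and its
  norm \<open>nX\<close>.  Carriers are used because \<open>Hardy p\<close> depends on the real number \<open>p\<close>.
\<close>

definition linear_map ::
    "('a \<Rightarrow> complex) set \<Rightarrow> ('b \<Rightarrow> complex) set \<Rightarrow> (('a \<Rightarrow> complex) \<Rightarrow> 'b \<Rightarrow> complex) \<Rightarrow> bool" where
  "linear_map X Y T \<longleftrightarrow>
     T ` X \<subseteq> Y \<and>
     (\<forall>f\<in>X. \<forall>g\<in>X. T (\<lambda>z. f z + g z) = (\<lambda>w. T f w + T g w)) \<and>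
     (\<forall>c. \<forall>f\<in>X. T (\<lambda>z. c * f z) = (\<lambda>w. c * T f w))"

definition bounded_operator ::
    "('a \<Rightarrow> complex) set \<Rightarrow> (('a \<Rightarrow> complex) \<Rightarrow> real) \<Rightarrow> ('b \<Rightarrow> complex) set \<Rightarrow> (('b \<Rightarrow> complex) \<Rightarrow> real)
      \<Rightarrow> (('a \<Rightarrow> complex) \<Rightarrow> 'b \<Rightarrow> complex) \<Rightarrow> bool" where
  "bounded_operator X nX Y nY T \<longleftrightarrow>
     linear_map X Y T \<and> (\<exists>B. \<forall>f\<in>X. nY (T f) \<le> B * nX f)"

text \<open>
  The locale \<open>Metric_space\<close> wants a distance that is nonnegative and symmetric on the whole type;
  the value 0 off the carrier has no influence on the topology.
\<close>

definition norm_dist ::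
    "('b \<Rightarrow> complex) set \<Rightarrow> (('b \<Rightarrow> complex) \<Rightarrow> real) \<Rightarrow> ('b \<Rightarrow> complex) \<Rightarrow> ('b \<Rightarrow> complex) \<Rightarrow> real" where
  "norm_dist Y nY f g = (if f \<in> Y \<and> g \<in> Y then nY (\<lambda>z. f z - g z) else 0)"

definition norm_topology ::
    "('b \<Rightarrow> complex) set \<Rightarrow> (('b \<Rightarrow> complex) \<Rightarrow> real) \<Rightarrow> ('b \<Rightarrow> complex) topology" where
  "norm_topology Y nY = Metric_space.mtopology Y (norm_dist Y nY)"

definition compact_operator ::
    "('a \<Rightarrow> complex) set \<Rightarrow> (('a \<Rightarrow> complex) \<Rightarrow> real) \<Rightarrow> ('b \<Rightarrow> complex) set \<Rightarrow> (('b \<Rightarrow> complex) \<Rightarrow> real)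
      \<Rightarrow> (('a \<Rightarrow> complex) \<Rightarrow> 'b \<Rightarrow> complex) \<Rightarrow> bool" where
  "compact_operator X nX Y nY K \<longleftrightarrow>
     linear_map X Y K \<and>
     compactin (norm_topology Y nY) (norm_topology Y nY closure_of (K ` {f \<in> X. nX f \<le> 1}))"

definition operator_norm ::
    "('a \<Rightarrow> complex) set \<Rightarrow> (('a \<Rightarrow> complex) \<Rightarrow> real) \<Rightarrow> (('b \<Rightarrow> complex) \<Rightarrow> real)
      \<Rightarrow> (('a \<Rightarrow> complex) \<Rightarrow> 'b \<Rightarrow> complex) \<Rightarrow> ennreal" where
  "operator_norm X nX nY T = (SUP f\<in>{f \<in> X. nX f \<le> 1}. ennreal (nY (T f)))"

definition essential_norm ::
    "('a \<Rightarrow> complex) set \<Rightarrow> (('a \<Rightarrow> complex) \<Rightarrow> real) \<Rightarrow> ('b \<Rightarrow> complex) set \<Rightarrow> (('b \<Rightarrow> complex) \<Rightarrow> real)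
      \<Rightarrow> (('a \<Rightarrow> complex) \<Rightarrow> 'b \<Rightarrow> complex) \<Rightarrow> ennreal" where
  "essential_norm X nX Y nY T =
     (INF K\<in>{K. compact_operator X nX Y nY K}. operator_norm X nX nY (\<lambda>f w. T f w - K f w))"

text \<open>
  In \<^typ>\<open>ennreal\<close> the supremum of the empty set is 0, and the limit exists because the suprema
  decrease in \<open>s\<close>.
\<close>

definition limsup_boundary :: "(complex \<Rightarrow> complex) \<Rightarrow> (complex \<Rightarrow> real) \<Rightarrow> ennreal" where
  "limsup_boundary \<phi> F = Lim (at_left (1::real)) (\<lambda>s. SUP z\<in>{z \<in> \<D>. s < cmod (\<phi> z)}. ennreal (F z))"

definition comparable :: "real \<Rightarrow> ennreal \<Rightarrow> ennreal \<Rightarrow> bool" where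
  "comparable C X Y \<longleftrightarrow> ennreal (inverse C) * Y \<le> X \<and> X \<le> ennreal C * Y"

text \<open>
  For \<open>a, z \<in> \<D>\<close> the number \<open>1 - cnj a * z\<close> has positive real part, so the principal branch of the
  power is analytic in \<open>z\<close>.
\<close>

definition test_p :: "real \<Rightarrow> complex \<Rightarrow> complex \<Rightarrow> complex" where
  "test_p p a = on_disk (\<lambda>z. of_real ((1 - (cmod a)\<^sup>2) powr (2 - 1 / p)) / (1 - cnj a * z)\<^sup>2)"

definition test_q :: "real \<Rightarrow> complex \<Rightarrow> complex \<Rightarrow> complex" where
  "test_q p a = on_disk (\<lambda>z. of_real ((1 - (cmod a)\<^sup>2)\<^sup>2) / (1 - cnj a * z) powr of_real (2 + 1 / p))"

lemma Bloch_diff_bound: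
  assumes f: "f \<in> Bloch" and g: "g \<in> Bloch" and z: "z \<in> \<D>"
  shows "(1 - (cmod z)\<^sup>2) * cmod (deriv (\<lambda>w. f w - g w) z)
    \<le> (1 - (cmod z)\<^sup>2) * cmod (deriv f z) + (1 - (cmod z)\<^sup>2) * cmod (deriv g z)"
proof -
  have "f field_differentiable at z" "g field_differentiable at z"
    using f g z by (auto simp: Bloch_def analytic_disk_def holomorphic_on_imp_differentiable_at)
  then have "deriv (\<lambda>w. f w - g w) z = deriv f z - deriv g z"
    by (rule deriv_diff)
  moreover have "0 \<le> 1 - (cmod z)\<^sup>2"
    using z by (simp add: power_le_one)
  ultimately show ?thesis
    by (metis distrib_left mult_left_mono norm_triangle_ineq4)
qed

lemma Bloch_diff:
  assumes f: "f \<in> Bloch" and g: "g \<in> Bloch"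
  shows "(\<lambda>z. f z - g z) \<in> Bloch"
proof -
  obtain A B where
    "\<forall>z\<in>\<D>. (1 - (cmod z)\<^sup>2) * cmod (deriv f z) \<le> A" "\<forall>z\<in>\<D>. (1 - (cmod z)\<^sup>2) * cmod (deriv g z) \<le> B"
    using f g by (auto simp: Bloch_def bdd_above_def)
  then have "\<forall>z\<in>\<D>. (1 - (cmod z)\<^sup>2) * cmod (deriv (\<lambda>w. f w - g w) z) \<le> A + B"
    using Bloch_diff_bound[OF f g] by fastforce
  then have "bdd_above ((\<lambda>z. (1 - (cmod z)\<^sup>2) * cmod (deriv (\<lambda>w. f w - g w) z)) ` \<D>)"
    by (auto simp: bdd_above_def)
  then show ?thesis
    using f g by (auto simp: Bloch_def analytic_disk_def intro!: holomorphic_intros)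
qed

lemma bloch_upper:
  assumes "f \<in> Bloch" "z \<in> \<D>"
  shows "(1 - (cmod z)\<^sup>2) * cmod (deriv f z) \<le> (SUP z\<in>\<D>. (1 - (cmod z)\<^sup>2) * cmod (deriv f z))"
  using assms by (intro cSUP_upper) (auto simp: Bloch_def)

lemma bloch_norm_nonneg:
  assumes "f \<in> Bloch"
  shows "0 \<le> bloch_norm f"
proof -
  have "0 \<le> (SUP z\<in>\<D>. (1 - (cmod z)\<^sup>2) * cmod (deriv f z))"
    using bloch_upper[OF assms, of 0] by simp (meson norm_ge_zero order_trans)
  then show ?thesis
    by (simp add: bloch_norm_def)
qed

lemma bloch_norm_diff_le:
  assumes f: "f \<in> Bloch" and g: "g \<in> Bloch"
  shows "bloch_norm (\<lambda>z. f z - g z) \<le> bloch_norm f + bloch_norm g"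
proof -
  have "(SUP z\<in>\<D>. (1 - (cmod z)\<^sup>2) * cmod (deriv (\<lambda>w. f w - g w) z))
    \<le> (SUP z\<in>\<D>. (1 - (cmod z)\<^sup>2) * cmod (deriv f z)) + (SUP z\<in>\<D>. (1 - (cmod z)\<^sup>2) * cmod (deriv g z))"
  proof (rule cSUP_least)
    show "(1 - (cmod z)\<^sup>2) * cmod (deriv (\<lambda>w. f w - g w) z)
      \<le> (SUP z\<in>\<D>. (1 - (cmod z)\<^sup>2) * cmod (deriv f z)) + (SUP z\<in>\<D>. (1 - (cmod z)\<^sup>2) * cmod (deriv g z))"
      if "z \<in> \<D>" for z
      using Bloch_diff_bound[OF f g that] bloch_upper[OF f that] bloch_upper[OF g that] by linarith
  qed simp
  then show ?thesis
    using norm_triangle_ineq4[of "f 0" "g 0"] by (simp add: bloch_norm_def)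
qed

lemma bloch_norm_uminus:
  assumes "f \<in> Bloch"
  shows "bloch_norm (\<lambda>z. - f z) = bloch_norm f"
proof -
  have "deriv (\<lambda>w. - f w) z = - deriv f z" if "z \<in> \<D>" for z
    using assms that
    by (intro deriv_minus) (auto simp: Bloch_def analytic_disk_def holomorphic_on_imp_differentiable_at)
  then show ?thesis
    by (simp add: bloch_norm_def)
qed

lemma bloch_norm_eq_0:
  assumes f: "f \<in> Bloch"
  shows "bloch_norm f = 0 \<longleftrightarrow> f = (\<lambda>z. 0)"
proof
  assume 0: "bloch_norm f = 0"
  have "0 \<le> (SUP z\<in>\<D>. (1 - (cmod z)\<^sup>2) * cmod (deriv f z))"
    using bloch_upper[OF f, of 0] by simp (meson norm_ge_zero order_trans)
  with 0 have f0: "f 0 = 0" and S: "(SUP z\<in>\<D>. (1 - (cmod z)\<^sup>2) * cmod (deriv f z)) = 0"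
    by (auto simp: bloch_norm_def add_nonneg_eq_0_iff)
  have "(f has_field_derivative 0) (at z within \<D>)" if z: "z \<in> \<D>" for z
  proof -
    have "0 < 1 - (cmod z)\<^sup>2"
      using z by (simp add: power_less_one_iff abs_square_less_1)
    moreover have "(1 - (cmod z)\<^sup>2) * cmod (deriv f z) \<le> 0"
      using bloch_upper[OF f z] S by simp
    ultimately have "deriv f z = 0"
      by (simp add: mult_le_0_iff)
    moreover have "(f has_field_derivative deriv f z) (at z)"
      using f z by (auto simp: Bloch_def analytic_disk_def intro!: holomorphic_derivI)
    ultimately show ?thesis
      by (metis has_field_derivative_at_within)
  qed
  then have "\<exists>c. \<forall>z\<in>\<D>. f z = c"
    by (intro has_field_derivative_zero_constant) auto
  then have "f z = 0" if "z \<in> \<D>" for z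
    using f0 that by (metis centre_in_ball zero_less_one)
  then show "f = (\<lambda>z. 0)"
    using f by (auto simp: Bloch_def analytic_disk_def)
qed (simp add: bloch_norm_def)

lemma Metric_space_Bloch: "Metric_space Bloch (norm_dist Bloch bloch_norm)"
proof
  show "0 \<le> norm_dist Bloch bloch_norm f g" for f g
    by (simp add: norm_dist_def bloch_norm_nonneg Bloch_diff)
  show "norm_dist Bloch bloch_norm f g = norm_dist Bloch bloch_norm g f" for f g
    using bloch_norm_uminus[OF Bloch_diff, of f g] by (simp add: norm_dist_def)
  show "norm_dist Bloch bloch_norm f g = 0 \<longleftrightarrow> f = g" if "f \<in> Bloch" "g \<in> Bloch" for f g
    using that by (auto simp: norm_dist_def bloch_norm_eq_0 Bloch_diff fun_eq_iff)
  show "norm_dist Bloch bloch_norm f h \<le> norm_dist Bloch bloch_norm f g + norm_dist Bloch bloch_norm g h"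
    if "f \<in> Bloch" "g \<in> Bloch" "h \<in> Bloch" for f g h
    using that bloch_norm_diff_le[of "\<lambda>z. f z - g z" "\<lambda>z. h z - g z"] bloch_norm_uminus[of "\<lambda>z. g z - h z"]
    by (simp add: norm_dist_def Bloch_diff)
qed

end

theory Submission
  imports Defs
begin

text \<open>
  Poisson's formula and convexity of \<open>x powr p\<close> give \<open>\<bar>f w\<bar> \<le> 8 * (1 - \<bar>w\<bar>\<^sup>2) powr (- 1 / p)\<close> on the unit
  ball of \<open>H\<^sup>p\<close>, and Cauchy's estimate the corresponding bound for \<open>f'\<close>.  Approximating \<open>u C\<^sub>\<phi>\<close> by
  \<open>f \<mapsto> u C\<^sub>\<phi> (f (r \<cdot>))\<close>, which is compact by Montel's theorem, and letting \<open>r \<rightarrow> 1\<close> bounds the essential norm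
  by the limits over \<open>\<bar>\<phi> z\<bar> \<rightarrow> 1\<close>; the error is uniformly small where \<open>\<bar>\<phi> z\<bar> \<le> s\<close>.  Those limits are in
  turn bounded by the norms of the images of the test functions, since at \<open>a = \<phi> z\<close> the values of
  \<open>p\<^sub>a\<close> and \<open>q\<^sub>a\<close> agree while their derivatives have different factors \<open>2\<close> and \<open>2 + 1 / p\<close>.

  For the remaining inequality the usual argument that the test functions converge weakly to 0 breaks
  down for \<open>p = 1\<close>.  Instead, for \<open>K\<close> compact and a sequence \<open>g n\<close> of test functions with \<open>\<bar>a n\<bar> \<rightarrow> 1\<close>,
  \<open>K (g n)\<close> is Cauchy along a subsequence, so the operator minus \<open>K\<close> is tested on \<open>g n - g m\<close>: with \<open>n\<close> fixed
  and \<open>m \<rightarrow> \<infinity>\<close>, the contribution of \<open>g m\<close> at any given point vanishes.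
\<close>

subsection \<open>Poisson integrals and Hardy means\<close>

text \<open>
  Cauchy's formula applied to \<open>f (r \<zeta>) (1 - \<bar>a\<bar>\<^sup>2) / (1 - cnj a * \<zeta>)\<close>, whose value at \<open>a\<close> is \<open>f (r a)\<close>.
\<close>

lemma poisson_formula:
  assumes f: "f holomorphic_on \<D>" and a: "a \<in> \<D>" and r: "0 < r" "r < 1"
  shows "((\<lambda>t. of_real ((1 - (cmod a)\<^sup>2) / (cmod (1 - cnj a * cis t))\<^sup>2) * f (of_real r * cis t))
    has_integral 2 * of_real pi * f (of_real r * a)) {0..2 * pi}"
proof -
  define g where "g = (\<lambda>\<zeta>. f (of_real r * \<zeta>) * (1 - (cmod a)\<^sup>2) / (1 - cnj a * \<zeta>))"
  have nz: "1 - cnj a * \<zeta> \<noteq> 0" if "cmod \<zeta> \<le> 1" for \<zeta>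
  proof
    assume "1 - cnj a * \<zeta> = 0"
    then have "cmod (cnj a * \<zeta>) = 1" by simp
    moreover have "cmod a * cmod \<zeta> \<le> cmod a * 1" using that by (intro mult_left_mono) auto
    ultimately show False using a by (simp add: norm_mult)
  qed
  have "(\<lambda>\<zeta>. f (of_real r * \<zeta>)) holomorphic_on cball 0 1"
  proof -
    have "f \<circ> (\<lambda>\<zeta>. of_real r * \<zeta>) holomorphic_on cball 0 1"
    proof (rule holomorphic_on_compose_gen[OF _ f])
      have "r * cmod \<zeta> < 1" if "cmod \<zeta> \<le> 1" for \<zeta>
        using mult_left_mono[OF that, of r] r by linarith
      then show "(\<lambda>\<zeta>. of_real r * \<zeta>) ` cball 0 1 \<subseteq> \<D>" using r by (auto simp: norm_mult)
    qed (intro holomorphic_intros)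
    then show ?thesis by (simp add: o_def)
  qed
  then have "g holomorphic_on cball 0 1"
    unfolding g_def using nz by (intro holomorphic_intros) auto
  then have "((\<lambda>u. g u / (u - a)) has_contour_integral (2 * of_real pi * \<i> * g a)) (circlepath 0 1)"
    using a by (intro Cauchy_integral_circlepath_simple) auto
  then have "((\<lambda>t. g (cis t) / (cis t - a) * \<i> * cis t) has_integral (2 * of_real pi * \<i> * g a)) {0..2 * pi}"
    unfolding circlepath_def by (subst (asm) has_contour_integral_part_circlepath_iff) auto
  \<comment> \<open>Multiplying by -i strips the factor i that the parametrisation of the circle
    contributes.\<close>
  from has_integral_mult_right[OF this, of "- \<i>"]
  have 1: "((\<lambda>t. g (cis t) / (cis t - a) * cis t) has_integral (2 * of_real pi * g a)) {0..2 * pi}"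
    by (simp add: mult_ac)
  have sq: "cnj x * x = (complex_of_real (cmod x))\<^sup>2" for x
    by (simp add: complex_norm_square mult.commute flip: of_real_power)
  have "g a = f (of_real r * a)"
    using nz[of a] a by (simp add: g_def sq)
  moreover have "g (cis t) / (cis t - a) * cis t =
      of_real ((1 - (cmod a)\<^sup>2) / (cmod (1 - cnj a * cis t))\<^sup>2) * f (of_real r * cis t)" for t
  proof -
    have "cis t \<noteq> a" using a by auto
    \<comment> \<open>On the unit circle \<open>cnj (cis t)\<close> is the inverse of
      \<open>cis t\<close>. Hence the Cauchy denominator and the auxiliary factor in g are conjugate
      up to \<open>cis t\<close>, and their product is the squared modulus in the Poisson
      kernel.\<close>
    have "(cis t - a) = cis t * cnj (1 - cnj a * cis t)"
      by (simp add: algebra_simps cis_cnj cis_mult flip: cis_inverse)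
    then have "g (cis t) / (cis t - a) * cis t = f (of_real r * cis t) * (1 - (cmod a)\<^sup>2)
        / (cnj (1 - cnj a * cis t) * (1 - cnj a * cis t))"
      by (simp add: g_def mult.commute)
    then show ?thesis unfolding sq by (simp add: mult.commute)
  qed
  ultimately show ?thesis using 1 by simp
qed

lemma one_minus_cnj_mult_bounds:
  assumes "a \<in> \<D>" "cmod z \<le> 1"
  shows "1 - cmod a \<le> cmod (1 - cnj a * z)" "1 - cnj a * z \<noteq> 0"
proof -
  have "cmod (cnj a * z) \<le> cmod a" using assms by (simp add: norm_mult mult_left_le)
  then show *: "1 - cmod a \<le> cmod (1 - cnj a * z)"
    using norm_triangle_ineq2[of 1 "cnj a * z"] by simp
  show "1 - cnj a * z \<noteq> 0" using * assms by auto
qed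

lemma poisson_kernel_integral:
  assumes a: "a \<in> \<D>"
  shows "((\<lambda>t. (1 - (cmod a)\<^sup>2) / (cmod (1 - cnj a * cis t))\<^sup>2) has_integral 2 * pi) {0..2 * pi}"
proof -
  \<comment> \<open>A constant function does not see the radius, so the value 1/2 used here is an
    arbitrary choice.\<close>
  have "((\<lambda>t. complex_of_real ((1 - (cmod a)\<^sup>2) / (cmod (1 - cnj a * cis t))\<^sup>2) * 1)
      has_integral 2 * of_real pi * 1) {0..2 * pi}"
    using poisson_formula[OF holomorphic_on_const a, of "1/2" 1] by simp
  from has_integral_Re[OF this] show ?thesis by simp
qed

text \<open>Convexity is applied on the open half-line, where the power is differentiable, so x = 0
  is split off. There the left side equals (1 - p) * m powr p, which is at most 0.\<close>

lemma powr_above_tangent: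
  fixes x m p :: real
  assumes "0 \<le> x" "0 < m" "1 \<le> p"
  shows "m powr p + p * m powr (p - 1) * (x - m) \<le> x powr p"
proof (cases "x = 0")
  case True
  have "m powr p = m powr (p - 1) * m" using assms by (simp add: powr_diff)
  then show ?thesis using True assms by (simp add: algebra_simps mult_right_mono)
next
  case False
  have "((\<lambda>x. x powr p) has_real_derivative p * m powr (p - 1)) (at m within {0<..})"
    using assms by (auto intro!: derivative_eq_intros simp: has_field_derivative_at_within)
  then have "x powr p - m powr p \<ge> p * m powr (p - 1) * (x - m)"
    using assms False by (intro convex_on_imp_above_tangent[OF powr_convex]) (auto simp: interior_open)
  then show ?thesis by simp
qed

lemma hardy_mean_cis:
  "hardy_mean p f r = 1 / (2 * pi) * integral {0..2 * pi} (\<lambda>t. cmod (f (of_real r * cis t)) powr p)"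
  by (simp add: hardy_mean_def cis_conv_exp)

lemma continuous_on_circle:
  assumes "f holomorphic_on \<D>" "0 < r" "r < 1"
  shows "continuous_on A (\<lambda>t. f (of_real r * cis t))"
  using assms by (intro continuous_on_compose2[OF holomorphic_on_imp_continuous_on[OF assms(1)]])
    (auto intro!: continuous_intros simp: norm_mult)

lemma continuous_on_hardy_integrand:
  assumes "f holomorphic_on \<D>" "0 < r" "r < 1" "0 < p"
  shows "continuous_on A (\<lambda>t. cmod (f (of_real r * cis t)) powr p)"
  using assms continuous_on_circle[OF assms(1-3)] by (intro continuous_on_powr' continuous_intros) auto

lemma integral_hardy_mean:
  "integral {0..2 * pi} (\<lambda>t. cmod (f (of_real r * cis t)) powr p) = 2 * pi * hardy_mean p f r"
  by (simp add: hardy_mean_cis)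

text \<open>
  Jensen's inequality for the Poisson kernel: integrate the tangent line of \<open>x powr p\<close> at
  \<open>m = \<bar>f (r a)\<bar>\<close>, using that \<open>m\<close> is at most the Poisson integral of \<open>\<bar>f\<bar>\<close>.
\<close>

lemma hardy_mean_pointwise:
  assumes f: "f holomorphic_on \<D>" and a: "a \<in> \<D>" and r: "0 < r" "r < 1" and p: "1 \<le> p"
  shows "cmod (f (of_real r * a)) powr p \<le> (1 + cmod a) / (1 - cmod a) * hardy_mean p f r"
proof -
  define P where "P = (\<lambda>t. (1 - (cmod a)\<^sup>2) / (cmod (1 - cnj a * cis t))\<^sup>2)"
  define F where "F = (\<lambda>t. cmod (f (of_real r * cis t)))"
  define m where "m = cmod (f (of_real r * a))"
  have a1: "cmod a < 1" using a by simp
  have Fp: "(\<lambda>t. F t powr p) integrable_on {0..2 * pi}"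
    unfolding F_def using f r p by (intro integrable_continuous_interval continuous_on_hardy_integrand) auto
  have contP: "continuous_on A P" for A
    unfolding P_def using one_minus_cnj_mult_bounds(2)[OF a] by (intro continuous_intros) auto
  have contF: "continuous_on A F" for A
    unfolding F_def by (intro continuous_intros continuous_on_circle f r)
  have contFp: "continuous_on A (\<lambda>t. F t powr p)" for A
    unfolding F_def using f r p by (intro continuous_on_hardy_integrand) auto
  have P0: "0 \<le> P t" for t using a1 by (simp add: P_def power_le_one)
  have Pmax: "P t \<le> (1 + cmod a) / (1 - cmod a)" for t
  proof -
    have "(1 - cmod a)\<^sup>2 \<le> (cmod (1 - cnj a * cis t))\<^sup>2"
      using one_minus_cnj_mult_bounds(1)[OF a, of "cis t"] a1 by (intro power_mono) auto
    then have "P t \<le> (1 - (cmod a)\<^sup>2) / (1 - cmod a)\<^sup>2"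
      unfolding P_def using a1 one_minus_cnj_mult_bounds(2)[OF a, of "cis t"]
      by (intro divide_left_mono mult_pos_pos zero_less_power) (auto simp: power_le_one)
    also have "\<dots> = ((1 + cmod a) * (1 - cmod a)) / ((1 - cmod a) * (1 - cmod a))"
      by (simp add: algebra_simps power2_eq_square)
    also have "\<dots> = (1 + cmod a) / (1 - cmod a)" using a1 by simp
    finally show ?thesis .
  qed
  have "0 \<le> hardy_mean p f r"
    unfolding hardy_mean_cis using Fp by (simp add: F_def integral_nonneg)
  show ?thesis
  \<comment> \<open>The tangent point must be positive; for m = 0 the left side is
    \<open>0 powr p\<close>, which is 0.\<close>
  proof (cases "m = 0")
    case True
    then show ?thesis using \<open>0 \<le> hardy_mean p f r\<close> a1 by (simp add: m_def)
  next
    case False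
    then have m: "0 < m" by (simp add: m_def)
    have PF: "2 * pi * m \<le> integral {0..2 * pi} (\<lambda>t. P t * F t)"
    proof -
      have "((\<lambda>t. of_real (P t) * f (of_real r * cis t)) has_integral 2 * of_real pi * f (of_real r * a)) {0..2 * pi}"
        unfolding P_def by (rule poisson_formula[OF f a r])
      moreover have "(\<lambda>t. P t * F t) integrable_on {0..2 * pi}"
        by (intro integrable_continuous_interval continuous_intros contP contF)
      ultimately have "cmod (integral {0..2 * pi} (\<lambda>t. of_real (P t) * f (of_real r * cis t)))
          \<le> integral {0..2 * pi} (\<lambda>t. P t * F t)"
        using P0 by (intro integral_norm_bound_integral) (auto simp: norm_mult F_def)
      also have "integral {0..2 * pi} (\<lambda>t. of_real (P t) * f (of_real r * cis t)) = 2 * of_real pi * f (of_real r * a)"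
        by (rule integral_unique) fact
      finally show ?thesis by (simp add: norm_mult m_def)
    qed
    \<comment> \<open>The added term is nonnegative by \<open>PF\<close>. Adding it turns the left
      side into the integral of the tangent line at m, evaluated at F t, against the kernel
      P.\<close>
    have "2 * pi * m powr p \<le> 2 * pi * m powr p + p * m powr (p - 1) * (integral {0..2 * pi} (\<lambda>t. P t * F t) - 2 * pi * m)"
      using PF p by simp
    also have "\<dots> = (m powr p - p * m powr (p - 1) * m) * (2 * pi)
        + p * m powr (p - 1) * integral {0..2 * pi} (\<lambda>t. P t * F t)"
      by (simp add: algebra_simps)
    also have "\<dots> = integral {0..2 * pi} (\<lambda>t. (m powr p - p * m powr (p - 1) * m) * P t + p * m powr (p - 1) * (P t * F t))"
    proof -
      have "(P has_integral 2 * pi) {0..2 * pi}"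
        unfolding P_def by (rule poisson_kernel_integral[OF a])
      moreover have "((\<lambda>t. P t * F t) has_integral integral {0..2 * pi} (\<lambda>t. P t * F t)) {0..2 * pi}"
        by (intro integrable_integral integrable_continuous_interval continuous_intros contP contF)
      ultimately show ?thesis
        by (intro integral_unique[symmetric] has_integral_add has_integral_mult_right)
    qed
    also have "\<dots> \<le> integral {0..2 * pi} (\<lambda>t. (1 + cmod a) / (1 - cmod a) * F t powr p)"
    proof (rule integral_le)
      fix t
      have "(m powr p - p * m powr (p - 1) * m) * P t + p * m powr (p - 1) * (P t * F t)
          = P t * (m powr p + p * m powr (p - 1) * (F t - m))" by (simp add: algebra_simps)
      also have "\<dots> \<le> P t * F t powr p"
        using powr_above_tangent[of "F t" m p] m p P0 by (intro mult_left_mono) (auto simp: F_def)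
      also have "\<dots> \<le> (1 + cmod a) / (1 - cmod a) * F t powr p"
        by (intro mult_right_mono Pmax) auto
      finally show "(m powr p - p * m powr (p - 1) * m) * P t + p * m powr (p - 1) * (P t * F t)
          \<le> (1 + cmod a) / (1 - cmod a) * F t powr p" .
    qed (intro integrable_continuous_interval continuous_intros contP contF contFp)+
    also have "\<dots> = 2 * pi * ((1 + cmod a) / (1 - cmod a) * hardy_mean p f r)"
      by (simp add: F_def integral_hardy_mean)
    finally show ?thesis unfolding m_def by (rule mult_left_le_imp_le) simp
  qed
qed

text \<open>For a non-integrable integrand \<open>integral\<close> takes the default value 0, so the
  claim holds for every f.\<close>

lemma hardy_mean_nonneg: "0 \<le> hardy_mean p f r"
proof (cases "(\<lambda>t. cmod (f (of_real r * cis t)) powr p) integrable_on {0..2 * pi}")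
  case True
  then show ?thesis by (simp add: hardy_mean_cis integral_nonneg)
qed (simp add: hardy_mean_cis not_integrable_integral)

lemma hardy_mean_le_norm:
  assumes f: "f \<in> Hardy p" and r: "0 < r" "r < 1" and p: "1 \<le> p"
  shows "hardy_mean p f r \<le> hardy_norm p f powr p"
proof -
  have le: "hardy_mean p f r \<le> (SUP r\<in>{0<..<1}. hardy_mean p f r)"
    using f r by (intro cSUP_upper) (auto simp: Hardy_def)
  then have "0 \<le> (SUP r\<in>{0<..<1}. hardy_mean p f r)"
    using hardy_mean_nonneg order_trans by blast
  then show ?thesis using le p by (simp add: hardy_norm_def powr_powr)
qed

lemma hardy_norm_nonneg: "0 \<le> hardy_norm p f"
  by (simp add: hardy_norm_def)

lemma hardy_norm_leI:
  assumes "\<And>r. 0 < r \<Longrightarrow> r < 1 \<Longrightarrow> hardy_mean p f r \<le> c powr p" "0 \<le> c" "1 \<le> p"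
  shows "hardy_norm p f \<le> c"
proof -
  have le: "(SUP r\<in>{0<..<1}. hardy_mean p f r) \<le> c powr p"
    using assms(1) by (intro cSUP_least) auto
  have "hardy_mean p f (1/2) \<le> (SUP r\<in>{0<..<1}. hardy_mean p f r)"
    using assms(1) by (intro cSUP_upper) (auto simp: bdd_above_def intro!: exI[of _ "c powr p"])
  then have "0 \<le> (SUP r\<in>{0<..<1}. hardy_mean p f r)"
    using hardy_mean_nonneg order_trans by blast
  then have "hardy_norm p f \<le> (c powr p) powr (1 / p)"
    unfolding hardy_norm_def using le assms by (intro powr_mono2) auto
  then show ?thesis using assms by (simp add: powr_powr)
qed

lemma HardyI:
  assumes "f \<in> analytic_disk" "\<And>r. 0 < r \<Longrightarrow> r < 1 \<Longrightarrow> hardy_mean p f r \<le> B"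
  shows "f \<in> Hardy p"
  using assms by (auto simp: Hardy_def bdd_above_def intro!: exI[of _ B])

lemma Hardy_holomorphic: "f \<in> Hardy p \<Longrightarrow> f holomorphic_on \<D>"
  by (simp add: Hardy_def analytic_disk_def)

section \<open>Growth of functions and their derivatives\<close>

lemma one_minus_norm_sq:
  assumes "cmod z < 1"
  shows "1 - cmod z \<le> 1 - (cmod z)\<^sup>2" "1 - (cmod z)\<^sup>2 \<le> 2 * (1 - cmod z)" "0 < 1 - (cmod z)\<^sup>2"
    "1 - (cmod z)\<^sup>2 \<le> 1"
proof -
  have "(cmod z)\<^sup>2 \<le> cmod z * 1" unfolding power2_eq_square using assms by (intro mult_left_mono) auto
  then show "1 - cmod z \<le> 1 - (cmod z)\<^sup>2" "0 < 1 - (cmod z)\<^sup>2" using assms by auto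
  have "0 \<le> (1 - cmod z)\<^sup>2" by simp
  then show "1 - (cmod z)\<^sup>2 \<le> 2 * (1 - cmod z)" by (simp add: power2_eq_square algebra_simps)
qed simp

text \<open>Apply \<open>hardy_mean_pointwise\<close> on the circle whose radius r is halfway
  between |w| and 1, at a = w / r. The Poisson factor becomes (1 + 3|w|) / (1 - |w|), at most 8 / (1
  - |w|^2). Taking p-th roots keeps the constant below 8 because p is at least 1.\<close>

lemma hardy_growth:
  assumes f: "f \<in> Hardy p" "hardy_norm p f \<le> 1" and w: "w \<in> \<D>" and p: "1 \<le> p"
  shows "cmod (f w) \<le> 8 * (1 - (cmod w)\<^sup>2) powr (- 1 / p)"
proof -
  define r where "r = (1 + cmod w) / 2"
  have w1: "cmod w < 1" using w by simp
  have r: "0 < r" "r < 1" and wr: "cmod w < r" using w1 by (auto simp: r_def add_pos_nonneg)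
  define a where "a = w / of_real r"
  have a: "cmod a = cmod w / r" using r by (simp add: a_def norm_divide)
  then have a1: "cmod a < 1" using wr r by simp
  have "hardy_mean p f r \<le> hardy_norm p f powr p" by (rule hardy_mean_le_norm[OF f(1) r p])
  also have "\<dots> \<le> 1 powr p" using f p hardy_norm_nonneg by (intro powr_mono2) auto
  finally have mean: "hardy_mean p f r \<le> 1" by simp
  have "cmod (f w) powr p = cmod (f (of_real r * a)) powr p" using r by (simp add: a_def)
  also have "\<dots> \<le> (1 + cmod a) / (1 - cmod a) * hardy_mean p f r"
    using a1 by (intro hardy_mean_pointwise[OF Hardy_holomorphic[OF f(1)] _ r p]) auto
  also have "\<dots> \<le> (1 + cmod a) / (1 - cmod a) * 1"
    using mean a1 by (intro mult_left_mono) auto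
  also have "\<dots> = (r + cmod w) / (r - cmod w)" using r wr by (simp add: a field_simps)
  also have "\<dots> = (1 + 3 * cmod w) / (1 - cmod w)" using w1 by (simp add: r_def field_simps)
  also have "\<dots> \<le> 4 / (1 - cmod w)" using w1 by (intro divide_right_mono) auto
  also have "\<dots> \<le> 8 / (1 - (cmod w)\<^sup>2)"
    using w1 one_minus_norm_sq[OF w1] by (simp add: field_simps)
  finally have "(cmod (f w) powr p) powr (1 / p) \<le> (8 / (1 - (cmod w)\<^sup>2)) powr (1 / p)"
    using p by (intro powr_mono2) auto
  also have "\<dots> = 8 powr (1 / p) * (1 - (cmod w)\<^sup>2) powr (- 1 / p)"
    using one_minus_norm_sq[OF w1] by (simp add: powr_divide powr_minus_divide)
  also have "\<dots> \<le> 8 powr 1 * (1 - (cmod w)\<^sup>2) powr (- 1 / p)"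
    using p by (intro mult_right_mono powr_mono) auto
  finally show ?thesis using p by (simp add: powr_powr)
qed

text \<open>Cauchy's estimate on the circle of radius \<open>\<rho>\<close> about w. The bound is
  asked for on a disk centred at 0 because the growth estimates are radial.\<close>

lemma deriv_bound:
  assumes h: "h holomorphic_on \<D>" and \<rho>: "0 < \<rho>" "cmod w + \<rho> < 1"
    and B: "\<And>z. cmod z \<le> cmod w + \<rho> \<Longrightarrow> cmod (h z) \<le> B"
  shows "cmod (deriv h w) \<le> B / \<rho>"
proof -
  have sub: "cmod z \<le> cmod w + \<rho>" if "cmod (w - z) \<le> \<rho>" for z
    using norm_triangle_ineq4[of w "w - z"] that by simp
  then have "cball w \<rho> \<subseteq> \<D>" using \<rho> by (force simp: dist_norm)
  then have "h holomorphic_on cball w \<rho>" using h holomorphic_on_subset by blast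
  then have "cmod ((deriv ^^ 1) h w) \<le> fact 1 * B / \<rho> ^ 1"
    using \<rho> sub B by (intro Cauchy_inequality)
      (auto intro: holomorphic_on_imp_continuous_on holomorphic_on_subset)
  then show ?thesis by simp
qed

text \<open>Cauchy's estimate with radius half the distance from w to the unit circle. On that disk
  1 - |z|^2 is at least b / 4, which costs 4 powr \<open>\<alpha>\<close>, hence at most 4. The
  radius is also at least b / 4, which costs another factor 4 and one power of b.\<close>

lemma deriv_growth:
  assumes h: "h holomorphic_on \<D>" and \<alpha>: "0 \<le> \<alpha>" "\<alpha> \<le> 1" and M: "0 \<le> M"
    and B: "\<And>z. z \<in> \<D> \<Longrightarrow> cmod (h z) \<le> M * (1 - (cmod z)\<^sup>2) powr (- \<alpha>)" and w: "w \<in> \<D>"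
  shows "cmod (deriv h w) \<le> 16 * M * (1 - (cmod w)\<^sup>2) powr (- \<alpha> - 1)"
proof -
  define b where "b = 1 - (cmod w)\<^sup>2"
  define \<rho> where "\<rho> = (1 - cmod w) / 2"
  have w1: "cmod w < 1" using w by simp
  note b = one_minus_norm_sq[OF w1, folded b_def]
  have "cmod (h z) \<le> 4 * M * b powr (- \<alpha>)" if "cmod z \<le> cmod w + \<rho>" for z
  proof -
    have z1: "cmod z < 1" using that w1 by (auto simp: \<rho>_def field_simps)
    have "b / 4 \<le> 1 - cmod z" using that b by (auto simp: \<rho>_def field_simps)
    also have "\<dots> \<le> 1 - (cmod z)\<^sup>2" by (rule one_minus_norm_sq(1)[OF z1])
    finally have "(1 - (cmod z)\<^sup>2) powr (- \<alpha>) \<le> (b / 4) powr (- \<alpha>)"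
      using b \<alpha> by (intro powr_mono2') auto
    also have "\<dots> = 4 powr \<alpha> * b powr (- \<alpha>)"
      using b by (simp add: powr_divide powr_minus_divide)
    also have "\<dots> \<le> 4 powr 1 * b powr (- \<alpha>)" using \<alpha> by (intro mult_right_mono powr_mono) auto
    finally have "M * (1 - (cmod z)\<^sup>2) powr (- \<alpha>) \<le> M * (4 * b powr (- \<alpha>))"
      using M by (intro mult_left_mono) auto
    then show ?thesis using B[of z] z1 by simp
  qed
  then have "cmod (deriv h w) \<le> 4 * M * b powr (- \<alpha>) / \<rho>"
    using w1 by (intro deriv_bound[OF h]) (auto simp: \<rho>_def field_simps)
  also have "\<dots> \<le> 4 * M * b powr (- \<alpha>) / (b / 4)"
    using b w1 M by (intro divide_left_mono) (auto simp: \<rho>_def)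
  also have "\<dots> = 16 * M * b powr (- \<alpha> - 1)" using b by (simp add: powr_diff)
  finally show ?thesis by (simp add: b_def)
qed

lemma on_disk_analytic: "f holomorphic_on \<D> \<Longrightarrow> on_disk f \<in> analytic_disk"
  using holomorphic_transform[of f \<D> "on_disk f"] by (simp add: analytic_disk_def on_disk_def)

lemma deriv_on_disk:
  assumes "z \<in> \<D>" shows "deriv (on_disk f) z = deriv f z"
proof (rule deriv_cong_ev)
  show "\<forall>\<^sub>F x in nhds z. on_disk f x = f x"
    using eventually_nhds_in_open[OF open_ball assms] by eventually_elim (simp add: on_disk_def)
qed simp

lemma on_disk_eq: "z \<in> \<D> \<Longrightarrow> on_disk f z = f z"
  by (simp add: on_disk_def)

subsection \<open>The test functions\<close>

text \<open>On the circle of radius r the denominator is that of the Poisson kernel at the point r *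
  a, and the numerator only grows when a is replaced by r * a. The mean of that kernel is 1.\<close>

lemma hardy_mean_le_kernel:
  assumes f: "f holomorphic_on \<D>" and a: "a \<in> \<D>" and r: "0 < r" "r < 1" and p: "1 \<le> p" and c: "0 \<le> c"
    and le: "\<And>z. z \<in> \<D> \<Longrightarrow> cmod (f z) powr p \<le> c * ((1 - (cmod a)\<^sup>2) / (cmod (1 - cnj a * z))\<^sup>2)"
  shows "hardy_mean p f r \<le> c"
proof -
  have "cmod a * r \<le> cmod a" using r by (simp add: mult_left_le)
  then have ra: "cmod (of_real r * a) \<le> cmod a" using r by (simp add: norm_mult mult.commute)
  then have ra': "of_real r * a \<in> \<D>" using a by auto
  let ?K = "\<lambda>t. (1 - (cmod (of_real r * a))\<^sup>2) / (cmod (1 - cnj (of_real r * a) * cis t))\<^sup>2"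
  have K: "(?K has_integral 2 * pi) {0..2 * pi}" by (rule poisson_kernel_integral[OF ra'])
  have "integral {0..2 * pi} (\<lambda>t. cmod (f (of_real r * cis t)) powr p) \<le> integral {0..2 * pi} (\<lambda>t. c * ?K t)"
  proof (rule integral_le)
    show "(\<lambda>t. c * ?K t) integrable_on {0..2 * pi}"
      using K by (intro integrable_on_mult_right) blast
    fix t
    have "cmod (f (of_real r * cis t)) powr p
        \<le> c * ((1 - (cmod a)\<^sup>2) / (cmod (1 - cnj (of_real r * a) * cis t))\<^sup>2)"
      using le[of "of_real r * cis t"] r by (simp add: norm_mult mult_ac)
    also have "\<dots> \<le> c * ?K t"
      using c ra by (intro mult_left_mono divide_right_mono diff_left_mono power_mono) auto
    finally show "cmod (f (of_real r * cis t)) powr p \<le> c * ?K t" .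
  qed (use f r p in \<open>intro integrable_continuous_interval continuous_on_hardy_integrand; simp\<close>)
  also have "\<dots> = c * (2 * pi)"
    by (rule integral_unique[OF has_integral_mult_right[OF K]])
  finally show ?thesis unfolding integral_hardy_mean by (simp add: mult.commute[of c])
qed

lemma test_holomorphic:
  assumes a: "a \<in> \<D>"
  shows "(\<lambda>z. of_real ((1 - (cmod a)\<^sup>2) powr (2 - 1 / p)) / (1 - cnj a * z)\<^sup>2) holomorphic_on \<D>"
    and "(\<lambda>z. of_real ((1 - (cmod a)\<^sup>2)\<^sup>2) / (1 - cnj a * z) powr of_real (2 + 1 / p)) holomorphic_on \<D>"
proof -
  have nz: "1 - cnj a * z \<noteq> 0" if "z \<in> \<D>" for z
    using one_minus_cnj_mult_bounds(2)[OF a, of z] that by simp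
  show "(\<lambda>z. of_real ((1 - (cmod a)\<^sup>2) powr (2 - 1 / p)) / (1 - cnj a * z)\<^sup>2) holomorphic_on \<D>"
    using nz by (intro holomorphic_intros) auto
  have "1 - cnj a * z \<notin> \<real>\<^sub>\<le>\<^sub>0" if z: "z \<in> \<D>" for z
  proof -
    have "cmod (cnj a * z) < 1"
      using a z mult_strict_mono'[of "cmod a" 1 "cmod z" 1] by (simp add: norm_mult)
    then have "0 < Re (1 - cnj a * z)" using complex_Re_le_cmod[of "cnj a * z"] by simp
    then show ?thesis by (auto simp: complex_nonpos_Reals_iff)
  qed
  then show "(\<lambda>z. of_real ((1 - (cmod a)\<^sup>2)\<^sup>2) / (1 - cnj a * z) powr of_real (2 + 1 / p)) holomorphic_on \<D>"
    using nz by (intro holomorphic_intros) auto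
qed

lemma test_analytic:
  assumes "a \<in> \<D>" shows "test_p p a \<in> analytic_disk" "test_q p a \<in> analytic_disk"
  unfolding test_p_def test_q_def by (intro on_disk_analytic test_holomorphic assms)+

lemma norm_test:
  assumes "z \<in> \<D>"
  shows "cmod (test_p p a z) = (1 - (cmod a)\<^sup>2) powr (2 - 1 / p) / (cmod (1 - cnj a * z))\<^sup>2"
    and "cmod (test_q p a z) = (1 - (cmod a)\<^sup>2)\<^sup>2 / cmod (1 - cnj a * z) powr (2 + 1 / p)"
  using assms by (auto simp: test_p_def test_q_def on_disk_eq norm_divide norm_power norm_powr_real_powr'
      simp del: of_real_add of_real_diff of_real_divide)

lemma test_hardy_mean:
  assumes a: "a \<in> \<D>" and p: "1 \<le> p" and r: "0 < r" "r < 1"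
  shows "hardy_mean p (test_p p a) r \<le> 4 powr p" "hardy_mean p (test_q p a) r \<le> 4 powr p"
proof -
  define b where "b = 1 - (cmod a)\<^sup>2"
  note b = one_minus_norm_sq[of a, folded b_def]
  \<comment> \<open>For both test functions the p-th power of the modulus has this shape, with
    \<open>\<gamma>\<close> equal to 2p - 2 for \<open>test_p\<close> and 2p - 1 for
    \<open>test_q\<close>. The factor b / d^2 has the shape required by
    \<open>hardy_mean_le_kernel\<close>, and the remaining power is at most 2 powr (2p), as b is at
    most 2d.\<close>
  have main: "(b / d) powr \<gamma> * (b / d\<^sup>2) \<le> 4 powr p * (b / d\<^sup>2)"
    if "b \<le> 2 * d" "0 < d" "0 \<le> \<gamma>" "\<gamma> \<le> 2 * p" for d \<gamma>
  proof -
    have "(b / d) powr \<gamma> \<le> 2 powr \<gamma>" using that b a by (intro powr_mono2) (auto simp: field_simps)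
    also have "\<dots> \<le> 2 powr (2 * p)" using that by (intro powr_mono) auto
    also have "\<dots> = 4 powr p" by (simp add: powr_powr[symmetric])
    finally show ?thesis using that b a by (intro mult_right_mono) auto
  qed
  have d: "b \<le> 2 * cmod (1 - cnj a * z)" "0 < cmod (1 - cnj a * z)" if "z \<in> \<D>" for z
    using one_minus_cnj_mult_bounds[OF a, of z] b a that by auto
  show "hardy_mean p (test_p p a) r \<le> 4 powr p"
  proof (rule hardy_mean_le_kernel[OF _ a r p])
    fix z assume z: "z \<in> \<D>"
    let ?d = "cmod (1 - cnj a * z)"
    have "cmod (test_p p a z) = b powr (2 - 1 / p) / ?d powr 2"
      using d[OF z] by (simp add: norm_test[OF z] b_def)
    then have "cmod (test_p p a z) powr p = b powr ((2 - 1 / p) * p) / ?d powr (2 * p)"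
      by (simp only: powr_divide powr_powr powr_ge_zero)
    also have "(2 - 1 / p) * p = (2 * p - 2) + 1" using p by (simp add: algebra_simps)
    also have "?d powr (2 * p) = ?d powr ((2 * p - 2) + 2)" by simp
    also have "b powr ((2 * p - 2) + 1) / ?d powr ((2 * p - 2) + 2) = (b / ?d) powr (2 * p - 2) * (b / ?d\<^sup>2)"
      using d[OF z] b a by (simp only: powr_add powr_divide) simp
    also have "\<dots> \<le> 4 powr p * (b / ?d\<^sup>2)" using d[OF z] p by (intro main) auto
    finally show "cmod (test_p p a z) powr p \<le> 4 powr p * ((1 - (cmod a)\<^sup>2) / ?d\<^sup>2)" by (simp add: b_def)
  qed (use test_analytic[OF a] in \<open>auto simp: analytic_disk_def\<close>)
  show "hardy_mean p (test_q p a) r \<le> 4 powr p"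
  proof (rule hardy_mean_le_kernel[OF _ a r p])
    fix z assume z: "z \<in> \<D>"
    let ?d = "cmod (1 - cnj a * z)"
    have "cmod (test_q p a z) = b powr 2 / ?d powr (2 + 1 / p)"
      using b a by (simp add: norm_test[OF z] b_def)
    then have "cmod (test_q p a z) powr p = b powr (2 * p) / ?d powr ((2 + 1 / p) * p)"
      by (simp only: powr_divide powr_powr powr_ge_zero)
    also have "(2 + 1 / p) * p = (2 * p - 1) + 2" using p by (simp add: algebra_simps)
    also have "b powr (2 * p) = b powr ((2 * p - 1) + 1)" by simp
    also have "b powr ((2 * p - 1) + 1) / ?d powr ((2 * p - 1) + 2) = (b / ?d) powr (2 * p - 1) * (b / ?d\<^sup>2)"
      using d[OF z] b a by (simp only: powr_add powr_divide) simp
    also have "\<dots> \<le> 4 powr p * (b / ?d\<^sup>2)" using d[OF z] p by (intro main) auto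
    finally show "cmod (test_q p a z) powr p \<le> 4 powr p * ((1 - (cmod a)\<^sup>2) / ?d\<^sup>2)" by (simp add: b_def)
  qed (use test_analytic[OF a] in \<open>auto simp: analytic_disk_def\<close>)
qed

text \<open>This is the quantitative form of locally uniform convergence to 0 as |a| tends to 1. The
  exponent 3 dominates both 2 and 2 + 1/p, so one bound serves both families, also for p =
  1.\<close>

lemma test_small:
  assumes a: "a \<in> \<D>" and p: "1 \<le> p" and z: "z \<in> \<D>"
  shows "cmod (test_p p a z) \<le> (1 - (cmod a)\<^sup>2) / (1 - cmod z) ^ 3"
    and "cmod (test_q p a z) \<le> (1 - (cmod a)\<^sup>2) / (1 - cmod z) ^ 3"
proof -
  define b where "b = 1 - (cmod a)\<^sup>2"
  note b = one_minus_norm_sq[of a, folded b_def]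
  define e where "e = 1 - cmod z"
  have e: "0 < e" "e \<le> 1" using z by (auto simp: e_def)
  define d where "d = cmod (1 - cnj a * z)"
  \<comment> \<open>Exchanging a and z only conjugates 1 - cnj a * z, so its modulus is also at
    least 1 - |z|.\<close>
  have d: "e \<le> d"
    using one_minus_cnj_mult_bounds(1)[OF z, of a] a complex_mod_cnj[of "1 - cnj a * z"]
    by (simp add: e_def d_def mult.commute)
  have "b powr (2 - 1 / p) \<le> b powr 1" using b a p by (intro powr_mono') auto
  then have b1: "b powr (2 - 1 / p) \<le> b" using b a by simp
  have "e ^ 3 \<le> e\<^sup>2" using e by (intro power_decreasing) auto
  also have "\<dots> \<le> d\<^sup>2" using e d by (intro power_mono) auto
  finally have "b powr (2 - 1 / p) / d\<^sup>2 \<le> b / e ^ 3" using b b1 a e d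
    by (intro frac_le) auto
  then show "cmod (test_p p a z) \<le> (1 - (cmod a)\<^sup>2) / (1 - cmod z) ^ 3"
    by (simp only: norm_test[OF z] b_def d_def e_def)
  have b2: "b\<^sup>2 \<le> b" using b a by (simp add: power2_eq_square mult_left_le)
  have "e ^ 3 = e powr 3" using e by simp
  also have "\<dots> \<le> e powr (2 + 1 / p)" using e p by (intro powr_mono') auto
  also have "\<dots> \<le> d powr (2 + 1 / p)" using e d p by (intro powr_mono2) auto
  finally have "b\<^sup>2 / d powr (2 + 1 / p) \<le> b / e ^ 3" using b b2 a e d
    by (intro frac_le) auto
  then show "cmod (test_q p a z) \<le> (1 - (cmod a)\<^sup>2) / (1 - cmod z) ^ 3"
    by (simp only: norm_test[OF z] b_def d_def e_def)
qed

lemma test_at: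
  assumes a: "a \<in> \<D>" and p: "1 \<le> p"
  shows "test_p p a a = of_real ((1 - (cmod a)\<^sup>2) powr (- 1 / p))"
    and "test_q p a a = of_real ((1 - (cmod a)\<^sup>2) powr (- 1 / p))"
    and "deriv (test_p p a) a = 2 * cnj a * of_real ((1 - (cmod a)\<^sup>2) powr (- 1 / p - 1))"
    and "deriv (test_q p a) a = of_real (2 + 1 / p) * cnj a * of_real ((1 - (cmod a)\<^sup>2) powr (- 1 / p - 1))"
proof -
  define b where "b = 1 - (cmod a)\<^sup>2"
  have b: "0 < b" using one_minus_norm_sq[of a] a by (simp add: b_def)
  \<comment> \<open>At z = a the base of the powers is the positive real b, so the principal branch
    reduces to real powers of b.\<close>
  have ab: "1 - cnj a * a = of_real b"
    by (simp add: b_def complex_norm_square mult.commute flip: of_real_power)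
  have nr: "of_real b \<notin> \<real>\<^sub>\<le>\<^sub>0" using b by simp
  have pw: "complex_of_real b powr of_real x = of_real (b powr x)" for x
    using b by (simp add: powr_of_real)
  show "test_p p a a = of_real ((1 - (cmod a)\<^sup>2) powr (- 1 / p))"
    using b by (simp add: test_p_def on_disk_eq[OF a] ab b_def[symmetric] powr_diff powr_minus_divide flip: of_real_power of_real_divide)
  show "test_q p a a = of_real ((1 - (cmod a)\<^sup>2) powr (- 1 / p))"
    using b by (simp only: test_q_def on_disk_eq[OF a] ab b_def[symmetric] pw flip: of_real_divide)
      (simp add: powr_add powr_minus_divide)
  have "((\<lambda>z. (1 - cnj a * z)\<^sup>2) has_field_derivative 2 * of_real b * - cnj a) (at a)"
    by (auto intro!: derivative_eq_intros simp: ab)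
  then have "((\<lambda>z. of_real (b powr (2 - 1 / p)) / (1 - cnj a * z)\<^sup>2) has_field_derivative
      - (of_real (b powr (2 - 1 / p)) * (2 * of_real b * - cnj a)) / ((of_real b)\<^sup>2)\<^sup>2) (at a)"
    using b by (auto intro!: derivative_eq_intros simp: ab power2_eq_square)
  then have "deriv (test_p p a) a =
      - (of_real (b powr (2 - 1 / p)) * (2 * of_real b * - cnj a)) / ((of_real b)\<^sup>2)\<^sup>2"
    unfolding test_p_def deriv_on_disk[OF a] b_def[symmetric] by (rule DERIV_imp_deriv)
  also have "\<dots> = 2 * cnj a * of_real (b powr (2 - 1 / p) * b / (b\<^sup>2)\<^sup>2)" by simp
  also have "b powr (2 - 1 / p) * b / (b\<^sup>2)\<^sup>2 = b powr (- 1 / p - 1)"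
  proof -
    have "b powr (2 - 1 / p) * b / (b\<^sup>2)\<^sup>2 = b powr (2 - 1 / p) / b ^ 3"
      using b by (simp add: power2_eq_square power3_eq_cube)
    also have "b ^ 3 = b powr 3" using b by simp
    also have "b powr (2 - 1 / p) / b powr 3 = b powr (2 - 1 / p - 3)" by (rule powr_diff[symmetric])
    also have "2 - 1 / p - 3 = - 1 / p - 1" by simp
    finally show ?thesis .
  qed
  finally show "deriv (test_p p a) a = 2 * cnj a * of_real ((1 - (cmod a)\<^sup>2) powr (- 1 / p - 1))"
    by (simp add: b_def)
  define s where "s = 2 + 1 / p"
  have s1: "complex_of_real s - 1 = of_real (s - 1)" by simp
  have "((\<lambda>z. (1 - cnj a * z) powr of_real s) has_field_derivative
      of_real s * (1 - cnj a * a) powr (of_real s - 1) * (- cnj a)) (at a)"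
    by (rule DERIV_chain2[OF has_field_derivative_powr])
      (use nr in \<open>auto simp: ab intro!: derivative_eq_intros\<close>)
  then have "((\<lambda>z. (1 - cnj a * z) powr of_real s) has_field_derivative
      of_real s * of_real (b powr (s - 1)) * (- cnj a)) (at a)"
    unfolding ab s1 pw .
  from DERIV_divide[OF DERIV_const[of "of_real (b\<^sup>2)"] this] have "((\<lambda>z. of_real (b\<^sup>2) / (1 - cnj a * z) powr of_real s) has_field_derivative
      - (of_real (b\<^sup>2) * (of_real s * of_real (b powr (s - 1)) * (- cnj a))) / (of_real (b powr s))\<^sup>2) (at a)"
    using b by (simp add: ab pw power2_eq_square)
  then have "deriv (test_q p a) a =
      - (of_real (b\<^sup>2) * (of_real s * of_real (b powr (s - 1)) * (- cnj a))) / (of_real (b powr s))\<^sup>2"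
    unfolding test_q_def deriv_on_disk[OF a] b_def[symmetric] s_def[symmetric] by (rule DERIV_imp_deriv)
  also have "\<dots> = of_real s * cnj a * of_real (b\<^sup>2 * b powr (s - 1) / (b powr s)\<^sup>2)" by simp
  also have "b\<^sup>2 * b powr (s - 1) / (b powr s)\<^sup>2 = b powr (- 1 / p - 1)"
  proof -
    have "b\<^sup>2 * b powr (s - 1) / (b powr s)\<^sup>2 = b powr 2 * b powr (s - 1) / b powr (s + s)"
      using b unfolding powr_add by (simp add: power2_eq_square)
    also have "\<dots> = b powr (2 + (s - 1) - (s + s))" by (simp only: powr_add powr_diff)
    also have "2 + (s - 1) - (s + s) = - 1 / p - 1" by (simp add: s_def)
    finally show ?thesis .
  qed
  finally show "deriv (test_q p a) a = of_real (2 + 1 / p) * cnj a * of_real ((1 - (cmod a)\<^sup>2) powr (- 1 / p - 1))"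
    by (simp add: b_def s_def)
qed

subsection \<open>The lower bound for the essential norm\<close>

lemma deriv_weighted_comp:
  assumes "u holomorphic_on \<D>" "\<phi> holomorphic_on \<D>" "\<phi> ` \<D> \<subseteq> \<D>" "f holomorphic_on \<D>" and z: "z \<in> \<D>"
  shows "deriv (weighted_comp u \<phi> f) z = deriv u z * f (\<phi> z) + u z * deriv \<phi> z * deriv f (\<phi> z)"
proof -
  have u': "(u has_field_derivative deriv u z) (at z)" and \<phi>': "(\<phi> has_field_derivative deriv \<phi> z) (at z)"
    and f': "(f has_field_derivative deriv f (\<phi> z)) (at (\<phi> z))"
    using assms by (auto intro!: holomorphic_derivI[OF _ open_ball])
  have "((\<lambda>z. u z * f (\<phi> z)) has_field_derivative
      deriv u z * f (\<phi> z) + u z * deriv \<phi> z * deriv f (\<phi> z)) (at z)"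
    using DERIV_mult[OF u' DERIV_chain2[OF f' \<phi>']] by (simp add: mult_ac add.commute)
  then show ?thesis
    unfolding weighted_comp_def deriv_on_disk[OF z] by (rule DERIV_imp_deriv)
qed

text \<open>With \<open>bloch_norm_le\<close> this presents the norm as a supremum of seminorms,
  each involving f only at 0 and its derivative at one point. The lower bound for the essential norm
  works with a single such seminorm.\<close>

lemma bloch_norm_ge:
  assumes "f \<in> Bloch" "z \<in> \<D>"
  shows "cmod (f 0) + (1 - (cmod z)\<^sup>2) * cmod (deriv f z) \<le> bloch_norm f"
  using bloch_upper[OF assms] by (simp add: bloch_norm_def)

lemma bloch_norm_le:
  assumes "\<And>z. z \<in> \<D> \<Longrightarrow> cmod (f 0) + (1 - (cmod z)\<^sup>2) * cmod (deriv f z) \<le> B"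
  shows "bloch_norm f \<le> B"
proof -
  have "(SUP z\<in>\<D>. (1 - (cmod z)\<^sup>2) * cmod (deriv f z)) \<le> B - cmod (f 0)"
    using assms by (intro cSUP_least) (auto simp: algebra_simps)
  then show ?thesis by (simp add: bloch_norm_def)
qed

lemma Bloch_holomorphic: "f \<in> Bloch \<Longrightarrow> f holomorphic_on \<D>"
  by (simp add: Bloch_def analytic_disk_def)

lemma bloch_norm_triangle:
  assumes f: "f \<in> Bloch" and g: "g \<in> Bloch"
  shows "bloch_norm f \<le> bloch_norm (\<lambda>z. f z - g z) + bloch_norm g"
proof -
  \<comment> \<open>Write - g as (g - g) - g, and then f as (f - g) - (- g), so that the lemmas on
    differences apply.\<close>
  have "(\<lambda>z. - g z) \<in> Bloch" using Bloch_diff[OF Bloch_diff[OF g g] g] by simp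
  from bloch_norm_diff_le[OF Bloch_diff[OF f g] this] show ?thesis
    by (simp add: bloch_norm_uminus[OF g])
qed

lemma bloch_norm_cmult_le:
  assumes f: "f \<in> Bloch"
  shows "bloch_norm (\<lambda>z. c * f z) \<le> cmod c * bloch_norm f"
proof (rule bloch_norm_le)
  fix z assume z: "z \<in> \<D>"
  have "f field_differentiable at z"
    using Bloch_holomorphic[OF f] z by (auto intro: holomorphic_on_imp_differentiable_at)
  then have "deriv (\<lambda>z. c * f z) z = c * deriv f z" by (rule deriv_cmult)
  then have "cmod (c * f 0) + (1 - (cmod z)\<^sup>2) * cmod (deriv (\<lambda>z. c * f z) z)
      = cmod c * (cmod (f 0) + (1 - (cmod z)\<^sup>2) * cmod (deriv f z))"
    by (simp add: norm_mult algebra_simps)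
  also have "\<dots> \<le> cmod c * bloch_norm f" using bloch_norm_ge[OF f z] by (intro mult_left_mono) auto
  finally show "cmod (c * f 0) + (1 - (cmod z)\<^sup>2) * cmod (deriv (\<lambda>z. c * f z) z) \<le> cmod c * bloch_norm f" .
qed

text \<open>\<open>Lim\<close> carries information only once convergence is known. The suprema
  decrease in s, so they converge to their infimum over s < 1; this gives both the limit and the
  upper bound by each single supremum.\<close>

lemma limsup_boundary_tendsto:
  "((\<lambda>s. SUP z\<in>{z \<in> \<D>. s < cmod (\<phi> z)}. ennreal (F z)) \<longlongrightarrow> limsup_boundary \<phi> F) (at_left (1::real))"
  and limsup_boundary_le:
  "s < 1 \<Longrightarrow> limsup_boundary \<phi> F \<le> (SUP z\<in>{z \<in> \<D>. s < cmod (\<phi> z)}. ennreal (F z))"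
proof -
  define S where "S = (\<lambda>s. SUP z\<in>{z \<in> \<D>. s < cmod (\<phi> z)}. ennreal (F z))"
  have anti: "S t \<le> S s" if "s \<le> t" for s t
    unfolding S_def using that by (intro SUP_subset_mono) auto
  define L where "L = (INF s\<in>{..<1}. S s)"
  have ev: "\<forall>\<^sub>F s in at_left (1::real). s \<in> {s0<..<1}" if "s0 < 1" for s0
    using that eventually_at_left_field by force
  have lim: "(S \<longlongrightarrow> L) (at_left 1)"
  proof (rule order_tendstoI)
    fix a assume "a < L"
    then have "a < S s" if "s \<in> {0<..<1}" for s
    proof -
      have "L \<le> S s" unfolding L_def using that by (intro INF_lower) auto
      then show ?thesis using \<open>a < L\<close> by simp
    qed
    then show "\<forall>\<^sub>F s in at_left 1. a < S s" using ev[of 0] by (auto elim: eventually_mono)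
  next
    fix a assume "L < a"
    then obtain s0 where s0: "s0 < 1" "S s0 < a" by (auto simp: L_def INF_less_iff)
    then have "S s < a" if "s \<in> {s0<..<1}" for s
      using that anti[of s0 s] by auto
    then show "\<forall>\<^sub>F s in at_left 1. S s < a" using ev[OF s0(1)] by (auto elim: eventually_mono)
  qed
  have L: "limsup_boundary \<phi> F = L"
    unfolding limsup_boundary_def S_def[symmetric] by (rule tendsto_Lim[OF _ lim]) simp
  show "((\<lambda>s. SUP z\<in>{z \<in> \<D>. s < cmod (\<phi> z)}. ennreal (F z)) \<longlongrightarrow> limsup_boundary \<phi> F) (at_left (1::real))"
    using lim by (simp add: L S_def)
  show "limsup_boundary \<phi> F \<le> (SUP z\<in>{z \<in> \<D>. s < cmod (\<phi> z)}. ennreal (F z))" if "s < 1"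
  proof -
    have "L \<le> S s" unfolding L_def using that by (intro INF_lower) auto
    then show ?thesis by (simp only: L S_def)
  qed
qed

text \<open>A pointwise inequality between p-th powers takes the place of Minkowski's inequality.
  The factor 2 powr p is compensated by scaling the test functions down.\<close>

lemma hardy_mean_diff:
  assumes f: "f holomorphic_on \<D>" and g: "g holomorphic_on \<D>" and r: "0 < r" "r < 1" and p: "1 \<le> p"
  shows "hardy_mean p (\<lambda>z. f z - g z) r \<le> 2 powr p * (hardy_mean p f r + hardy_mean p g r)"
proof -
  have le: "cmod (x - y) powr p \<le> 2 powr p * (cmod x powr p + cmod y powr p)" for x y
  proof -
    have "cmod (x - y) \<le> 2 * max (cmod x) (cmod y)" using norm_triangle_ineq4[of x y] by simp
    then have "cmod (x - y) powr p \<le> (2 * max (cmod x) (cmod y)) powr p" using p by (intro powr_mono2) auto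
    also have "\<dots> = 2 powr p * max (cmod x) (cmod y) powr p" by (simp add: powr_mult)
    also have "\<dots> \<le> 2 powr p * (cmod x powr p + cmod y powr p)"
      by (intro mult_left_mono) (auto simp: max_def)
    finally show ?thesis .
  qed
  have int: "(\<lambda>t. cmod (h (of_real r * cis t)) powr p) integrable_on {0..2 * pi}" if "h holomorphic_on \<D>" for h
    using that r p by (intro integrable_continuous_interval continuous_on_hardy_integrand) auto
  have "2 * pi * hardy_mean p (\<lambda>z. f z - g z) r \<le> integral {0..2 * pi}
      (\<lambda>t. 2 powr p * (cmod (f (of_real r * cis t)) powr p + cmod (g (of_real r * cis t)) powr p))"
    unfolding integral_hardy_mean[symmetric]
    by (intro integral_le le integrable_on_mult_right integrable_add int[OF f] int[OF g]
        int[OF holomorphic_on_diff[OF f g]])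
  also have "\<dots> = 2 powr p * (2 * pi * hardy_mean p f r + 2 * pi * hardy_mean p g r)"
    using integral_add[OF int[OF f] int[OF g]] by (simp add: integral_hardy_mean)
  also have "\<dots> = 2 * pi * (2 powr p * (hardy_mean p f r + hardy_mean p g r))" by (simp add: algebra_simps)
  finally show ?thesis by (rule mult_left_le_imp_le) simp
qed

lemma hardy_mean_cmult:
  "hardy_mean p (\<lambda>z. c * f z) r = cmod c powr p * hardy_mean p f r"
  by (simp add: hardy_mean_cis norm_mult powr_mult)

lemma analytic_disk_diff: "f \<in> analytic_disk \<Longrightarrow> g \<in> analytic_disk \<Longrightarrow> (\<lambda>z. f z - g z) \<in> analytic_disk"
  by (auto simp: analytic_disk_def intro!: holomorphic_intros)

lemma analytic_disk_cmult: "f \<in> analytic_disk \<Longrightarrow> (\<lambda>z. c * f z) \<in> analytic_disk"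
  by (auto simp: analytic_disk_def intro!: holomorphic_intros)

lemma Hardy_cmult:
  assumes "f \<in> Hardy p" "1 \<le> p" shows "(\<lambda>z. c * f z) \<in> Hardy p"
proof (rule HardyI)
  fix r :: real assume "0 < r" "r < 1"
  then show "hardy_mean p (\<lambda>z. c * f z) r \<le> cmod c powr p * hardy_norm p f powr p"
    unfolding hardy_mean_cmult using assms by (intro mult_left_mono hardy_mean_le_norm) auto
qed (use assms in \<open>auto simp: Hardy_def intro: analytic_disk_cmult\<close>)

text \<open>The constant 1/4 absorbs the loss in \<open>hardy_mean_diff\<close>: the two means add
  up to at most 2 * (1/4) powr p, the factor 2 is at most 2 powr p, and (2 * 2 * (1/4)) powr p =
  1.\<close>

lemma Hardy_diff_quarter:
  assumes f: "f \<in> analytic_disk" "\<And>r. 0 < r \<Longrightarrow> r < 1 \<Longrightarrow> hardy_mean p f r \<le> (1/4) powr p"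
    and g: "g \<in> analytic_disk" "\<And>r. 0 < r \<Longrightarrow> r < 1 \<Longrightarrow> hardy_mean p g r \<le> (1/4) powr p"
    and p: "1 \<le> p"
  shows "(\<lambda>z. f z - g z) \<in> Hardy p" "hardy_norm p (\<lambda>z. f z - g z) \<le> 1"
proof -
  have *: "hardy_mean p (\<lambda>z. f z - g z) r \<le> 1 powr p" if r: "0 < r" "r < 1" for r
  proof -
    have "hardy_mean p (\<lambda>z. f z - g z) r \<le> 2 powr p * (hardy_mean p f r + hardy_mean p g r)"
      using f g r p by (intro hardy_mean_diff) (auto simp: analytic_disk_def)
    also have "\<dots> \<le> 2 powr p * (2 * (1/4) powr p)" using f(2) g(2) r by (intro mult_left_mono) force+
    also have "\<dots> \<le> 2 powr p * (2 powr p * (1/4) powr p)"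
      using powr_mono[of 1 p 2] p by (intro mult_left_mono mult_right_mono) auto
    also have "\<dots> = (2 * (2 * (1/4))) powr p" by (simp only: powr_mult)
    finally show ?thesis by simp
  qed
  then show "(\<lambda>z. f z - g z) \<in> Hardy p" using f g by (intro HardyI analytic_disk_diff) auto
  show "hardy_norm p (\<lambda>z. f z - g z) \<le> 1" using * p by (intro hardy_norm_leI) auto
qed

text \<open>\<open>linear_map\<close> speaks of sums and multiples only, and X is an arbitrary set.
  Therefore the negative of g is required to lie in X.\<close>

lemma linear_map_diff:
  assumes "linear_map X Y K" "f \<in> X" "g \<in> X" "(\<lambda>z. -1 * g z) \<in> X"
  shows "K (\<lambda>z. f z - g z) = (\<lambda>w. K f w - K g w)"
proof -
  have add: "\<forall>f\<in>X. \<forall>g\<in>X. K (\<lambda>z. f z + g z) = (\<lambda>w. K f w + K g w)"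
    and mult: "\<forall>c. \<forall>f\<in>X. K (\<lambda>z. c * f z) = (\<lambda>w. c * K f w)"
    using assms(1) by (simp_all add: linear_map_def)
  have "K (\<lambda>z. f z + (-1 * g z)) = (\<lambda>w. K f w + K (\<lambda>z. -1 * g z) w)"
    by (rule add[rule_format, OF assms(2,4)])
  moreover have "K (\<lambda>z. -1 * g z) = (\<lambda>w. -1 * K g w)"
    by (rule mult[rule_format, OF assms(3)])
  ultimately show ?thesis by simp
qed

lemma weighted_comp_diff:
  "weighted_comp u \<phi> (\<lambda>z. f z - g z) = (\<lambda>w. weighted_comp u \<phi> f w - weighted_comp u \<phi> g w)"
  by (auto simp: weighted_comp_def on_disk_def algebra_simps)

lemma weighted_comp_cmult:
  "weighted_comp u \<phi> (\<lambda>z. c * f z) = (\<lambda>w. c * weighted_comp u \<phi> f w)"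
  by (auto simp: weighted_comp_def on_disk_def algebra_simps)

text \<open>Sequential compactness of the closed image of the unit ball gives a convergent
  subsequence. The conclusion is phrased as a Cauchy property because two of its members will be
  subtracted from each other.\<close>

lemma compact_operator_cauchy_subsequence:
  assumes K: "compact_operator X nX Bloch bloch_norm K" and g: "\<And>n. g n \<in> X" "\<And>n. nX (g n) \<le> 1"
  shows "\<exists>r. strict_mono (r :: nat \<Rightarrow> nat) \<and>
    (\<forall>e>0. \<exists>N. \<forall>m\<ge>N. \<forall>n\<ge>N. bloch_norm (\<lambda>z. K (g (r m)) z - K (g (r n)) z) < e)"
proof -
  interpret B: Metric_space Bloch "norm_dist Bloch bloch_norm" by (rule Metric_space_Bloch)
  have lin: "linear_map X Bloch K"
    and comp: "compactin B.mtopology (B.mtopology closure_of (K ` {f \<in> X. nX f \<le> 1}))"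
    using K by (auto simp: compact_operator_def norm_topology_def)
  have KB: "K (g n) \<in> Bloch" for n using lin g by (auto simp: linear_map_def)
  have "K ` {f \<in> X. nX f \<le> 1} \<subseteq> B.mtopology closure_of (K ` {f \<in> X. nX f \<le> 1})"
    using lin by (intro closure_of_subset) (auto simp: linear_map_def)
  then have "range (\<lambda>n. K (g n)) \<subseteq> B.mtopology closure_of (K ` {f \<in> X. nX f \<le> 1})"
    using g by blast
  from conjunct2[OF comp[unfolded B.compactin_sequentially], rule_format, OF this]
  obtain l r where r: "strict_mono (r :: nat \<Rightarrow> nat)"
    and lim: "limitin B.mtopology ((\<lambda>n. K (g n)) \<circ> r) l sequentially"
    by blast
  have l: "l \<in> Bloch" using lim by (simp add: B.limitin_metric)
  have "\<exists>N. \<forall>m\<ge>N. \<forall>n\<ge>N. bloch_norm (\<lambda>z. K (g (r m)) z - K (g (r n)) z) < e" if "0 < e" for e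
  proof -
    have "\<exists>N. \<forall>n\<ge>N. K (g (r n)) \<in> Bloch \<and> norm_dist Bloch bloch_norm (K (g (r n))) l < e / 2"
      using lim[unfolded B.limit_metric_sequentially, THEN conjunct2, rule_format, of "e / 2"] that by simp
    then obtain N where N: "\<And>n. n \<ge> N \<Longrightarrow> norm_dist Bloch bloch_norm (K (g (r n))) l < e / 2"
      by blast
    have "bloch_norm (\<lambda>z. K (g (r m)) z - K (g (r n)) z) < e" if "m \<ge> N" "n \<ge> N" for m n
      using B.triangle[of "K (g (r m))" l "K (g (r n))"] B.commute[of l "K (g (r n))"] N[OF that(1)] N[OF that(2)] KB l
      by (simp add: norm_dist_def)
    then show ?thesis by blast
  qed
  then show ?thesis using r by blast
qed

text \<open>The left side depends on f only through its values at \<open>\<phi> 0\<close> and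
  \<open>\<phi> w\<close> and its derivative at \<open>\<phi> w\<close>. So Q may depend on w, but
  not on f or \<open>\<epsilon>\<close>.\<close>

lemma bloch_local_bound:
  assumes u: "u holomorphic_on \<D>" and \<phi>: "\<phi> holomorphic_on \<D>" "\<phi> ` \<D> \<subseteq> \<D>" and w: "w \<in> \<D>"
  shows "\<exists>Q. \<forall>f \<epsilon>. f holomorphic_on \<D> \<longrightarrow> (\<forall>z\<in>\<D>. cmod (f z) \<le> \<epsilon> / (1 - cmod z) ^ 3) \<longrightarrow>
    cmod (weighted_comp u \<phi> f 0) + (1 - (cmod w)\<^sup>2) * cmod (deriv (weighted_comp u \<phi> f) w) \<le> \<epsilon> * Q"
proof -
  define e where "e = 1 - cmod (\<phi> w)"
  define e0 where "e0 = 1 - cmod (\<phi> 0)"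
  \<comment> \<open>The summands belong to f at \<open>\<phi> 0\<close>, f at
    \<open>\<phi> w\<close> and the derivative at \<open>\<phi> w\<close>. The last comes from
    Cauchy's estimate with radius e / 2, where 1 - |z| is still at least e / 2.\<close>
  define Q where "Q = cmod (u 0) / e0 ^ 3 + (1 - (cmod w)\<^sup>2) *
      (cmod (deriv u w) / e ^ 3 + cmod (u w * deriv \<phi> w) / (e / 2) ^ 3 / (e / 2))"
  have d: "\<phi> w \<in> \<D>" "\<phi> 0 \<in> \<D>" using image_subset_iff[THEN iffD1, OF \<phi>(2)] w by simp_all
  then have e: "0 < e" "0 < e0" by (auto simp: e_def e0_def)
  have "cmod (weighted_comp u \<phi> f 0) + (1 - (cmod w)\<^sup>2) * cmod (deriv (weighted_comp u \<phi> f) w) \<le> \<epsilon> * Q"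
    if f: "f holomorphic_on \<D>" and "\<forall>z\<in>\<D>. cmod (f z) \<le> \<epsilon> / (1 - cmod z) ^ 3" for f \<epsilon>
  proof -
    note le = bspec[OF that(2)]
    \<comment> \<open>The bound at z = 0 forces \<open>\<epsilon>\<close> to be nonnegative.\<close>
    have "cmod (f 0) \<le> \<epsilon>" using le[of 0] by simp
    then have "0 \<le> \<epsilon>" by (rule order_trans[OF norm_ge_zero])
    have "cmod (weighted_comp u \<phi> f 0) = cmod (u 0) * cmod (f (\<phi> 0))"
      by (simp add: weighted_comp_def on_disk_def norm_mult)
    also have "\<dots> \<le> cmod (u 0) * (\<epsilon> / e0 ^ 3)"
      using le[OF d(2)] unfolding e0_def by (rule mult_left_mono) simp
    finally have 1: "cmod (weighted_comp u \<phi> f 0) \<le> cmod (u 0) * (\<epsilon> / e0 ^ 3)" .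
    have 2: "cmod (deriv f (\<phi> w)) \<le> \<epsilon> / (e / 2) ^ 3 / (e / 2)"
    proof (rule deriv_bound[OF f])
      fix z assume z: "cmod z \<le> cmod (\<phi> w) + e / 2"
      then have z1: "e / 2 \<le> 1 - cmod z" by (simp add: e_def field_simps)
      then have "cmod (f z) \<le> \<epsilon> / (1 - cmod z) ^ 3" using e by (intro le) auto
      also have "\<dots> \<le> \<epsilon> / (e / 2) ^ 3" using z1 e \<open>0 \<le> \<epsilon>\<close>
        by (intro divide_left_mono power_mono mult_pos_pos zero_less_power) auto
      finally show "cmod (f z) \<le> \<epsilon> / (e / 2) ^ 3" .
    qed (use e in \<open>auto simp: e_def field_simps\<close>)
    have "cmod (deriv (weighted_comp u \<phi> f) w)
        \<le> cmod (deriv u w) * cmod (f (\<phi> w)) + cmod (u w * deriv \<phi> w) * cmod (deriv f (\<phi> w))"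
      unfolding deriv_weighted_comp[OF u \<phi> f w]
      using norm_triangle_ineq[of "deriv u w * f (\<phi> w)" "u w * deriv \<phi> w * deriv f (\<phi> w)"]
      by (simp add: norm_mult)
    also have "\<dots> \<le> cmod (deriv u w) * (\<epsilon> / e ^ 3) + cmod (u w * deriv \<phi> w) * (\<epsilon> / (e / 2) ^ 3 / (e / 2))"
      using le[OF d(1)] 2 unfolding e_def by (intro add_mono mult_left_mono norm_ge_zero)
    also have "\<dots> = \<epsilon> * (cmod (deriv u w) / e ^ 3 + cmod (u w * deriv \<phi> w) / (e / 2) ^ 3 / (e / 2))"
      by (simp add: distrib_left mult.left_commute)
    finally have "(1 - (cmod w)\<^sup>2) * cmod (deriv (weighted_comp u \<phi> f) w) \<le> (1 - (cmod w)\<^sup>2) *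
        (\<epsilon> * (cmod (deriv u w) / e ^ 3 + cmod (u w * deriv \<phi> w) / (e / 2) ^ 3 / (e / 2)))"
      using one_minus_norm_sq[of w] w by (intro mult_left_mono) auto
    from add_mono[OF 1 this] show ?thesis
      by (simp add: Q_def distrib_left mult.left_commute mult.commute[of _ \<epsilon>])
  qed
  then show ?thesis by blast
qed

text \<open>The choices are made in this order: an index N past which the K-images differ by less
  than e/2, a point w where the image of \<open>g (r N)\<close> almost attains its norm, and an
  index m, depending on w, for which the image of \<open>g (r m)\<close> is negligible at w.\<close>

lemma compact_perturbation_lower_bound:
  assumes u: "u holomorphic_on \<D>" and \<phi>: "\<phi> holomorphic_on \<D>" "\<phi> ` \<D> \<subseteq> \<D>" and p: "1 \<le> p"
    and T: "linear_map (Hardy p) Bloch (weighted_comp u \<phi>)"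
    and K: "compact_operator (Hardy p) (hardy_norm p) Bloch bloch_norm K"
    and g: "\<And>n. g n \<in> analytic_disk" "\<And>n r. 0 < r \<Longrightarrow> r < 1 \<Longrightarrow> hardy_mean p (g n) r \<le> (1/4) powr p"
    and small: "\<And>n z. z \<in> \<D> \<Longrightarrow> cmod (g n z) \<le> \<epsilon> n / (1 - cmod z) ^ 3" and \<epsilon>: "\<epsilon> \<longlonglongrightarrow> 0"
    and c: "\<And>n. c \<le> bloch_norm (weighted_comp u \<phi> (g n))"
  shows "ennreal c \<le> operator_norm (Hardy p) (hardy_norm p) bloch_norm (\<lambda>f w. weighted_comp u \<phi> f w - K f w)"
    (is "_ \<le> ?N")
proof (rule ennreal_le_epsilon)
  fix e :: real assume e: "0 < e"
  define T where "T = weighted_comp u \<phi>"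
  have T_Bloch: "T f \<in> Bloch" if "f \<in> Hardy p" for f using T that by (auto simp: linear_map_def T_def)
  have K_lin: "linear_map (Hardy p) Bloch K" using K by (simp add: compact_operator_def)
  have K_Bloch: "K f \<in> Bloch" if "f \<in> Hardy p" for f using K_lin that by (auto simp: linear_map_def)
  have gH: "g n \<in> Hardy p" for n using g by (intro HardyI) auto
  have "(1/4) powr p \<le> 1 powr p" using p by (intro powr_mono2) auto
  then have gn: "hardy_norm p (g n) \<le> 1" for n
    using g(2) p by (intro hardy_norm_leI) (auto intro: order_trans)
  obtain r :: "nat \<Rightarrow> nat" where r: "strict_mono r" and Cauchy:
    "\<forall>e>0. \<exists>N. \<forall>m\<ge>N. \<forall>n\<ge>N. bloch_norm (\<lambda>z. K (g (r m)) z - K (g (r n)) z) < e"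
    using compact_operator_cauchy_subsequence[where g = g, OF K gH gn] by blast
  obtain N where N: "\<And>m n. m \<ge> N \<Longrightarrow> n \<ge> N \<Longrightarrow> bloch_norm (\<lambda>z. K (g (r m)) z - K (g (r n)) z) < e / 2"
    using Cauchy[rule_format, of "e / 2"] e by (auto simp del: less_divide_eq_numeral1)
  \<comment> \<open>The error e is spent as e/4 for the choice of w, e/4 for \<open>g (r m)\<close>
    and e/2 for K h.\<close>
  define q where "q = (\<lambda>w f. cmod (T f 0) + (1 - (cmod w)\<^sup>2) * cmod (deriv (T f) w))"
  have "\<exists>w\<in>\<D>. c - e / 4 < q w (g (r N))"
  proof (rule ccontr)
    assume "\<not> (\<exists>w\<in>\<D>. c - e / 4 < q w (g (r N)))"
    then have "q w (g (r N)) \<le> c - e / 4" if "w \<in> \<D>" for w using that by (meson not_less)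
    then have "bloch_norm (T (g (r N))) \<le> c - e / 4"
      unfolding q_def by (rule bloch_norm_le)
    then show False using c[of "r N"] e by (simp add: T_def)
  qed
  then obtain w where w: "w \<in> \<D>" "c - e / 4 < q w (g (r N))" by blast
  obtain Q where Q: "\<forall>f \<epsilon>. f holomorphic_on \<D> \<longrightarrow> (\<forall>z\<in>\<D>. cmod (f z) \<le> \<epsilon> / (1 - cmod z) ^ 3) \<longrightarrow>
      q w f \<le> \<epsilon> * Q"
    unfolding q_def T_def using bloch_local_bound[OF u \<phi> w(1)] by (rule exE)
  have "(\<lambda>m. \<epsilon> (r m) * Q) \<longlonglongrightarrow> 0 * Q"
    using LIMSEQ_subseq_LIMSEQ[OF \<epsilon> r] by (intro tendsto_mult tendsto_const) (simp add: o_def)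
  then have "\<forall>\<^sub>F m in sequentially. \<epsilon> (r m) * Q < e / 4"
    using e by (intro order_tendstoD(2)[where y = 0]) simp_all
  then obtain M where M: "\<And>m. m \<ge> M \<Longrightarrow> \<epsilon> (r m) * Q < e / 4" by (auto simp: eventually_sequentially)
  define m where "m = max M N"
  have qm: "q w (g (r m)) < e / 4"
    using Q[rule_format, OF Hardy_holomorphic[OF gH] small, of "r m"] M[of m] by (simp add: m_def)
  define h where "h = (\<lambda>z. g (r N) z - g (r m) z)"
  have h: "h \<in> Hardy p" "hardy_norm p h \<le> 1"
    unfolding h_def using g p by (auto intro!: Hardy_diff_quarter)
  have Th: "T h = (\<lambda>z. T (g (r N)) z - T (g (r m)) z)"
    unfolding T_def h_def by (rule weighted_comp_diff)
  have Kh: "K h = (\<lambda>z. K (g (r N)) z - K (g (r m)) z)"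
    unfolding h_def by (rule linear_map_diff[OF K_lin]) (use gH Hardy_cmult[OF gH p, of "-1"] in auto)
  \<comment> \<open>This is the reverse triangle inequality for the seminorm q w, separately for the
    value at 0 and the derivative at w.\<close>
  have "q w (g (r N)) - q w (g (r m)) \<le> q w h"
  proof -
    have "(T (g n)) field_differentiable at w" for n
      by (rule holomorphic_on_imp_differentiable_at[OF Bloch_holomorphic[OF T_Bloch[OF gH]] open_ball w(1)])
    then have "deriv (T h) w = deriv (T (g (r N))) w - deriv (T (g (r m))) w"
      unfolding Th by (intro deriv_diff)
    then have "cmod (deriv (T (g (r N))) w) - cmod (deriv (T (g (r m))) w) \<le> cmod (deriv (T h) w)"
      by (simp add: norm_triangle_ineq2)
    then have "(1 - (cmod w)\<^sup>2) * (cmod (deriv (T (g (r N))) w) - cmod (deriv (T (g (r m))) w))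
        \<le> (1 - (cmod w)\<^sup>2) * cmod (deriv (T h) w)"
      using one_minus_norm_sq[of w] w by (intro mult_left_mono) auto
    moreover have "cmod (T (g (r N)) 0) - cmod (T (g (r m)) 0) \<le> cmod (T h 0)"
      unfolding Th by (rule norm_triangle_ineq2)
    ultimately show ?thesis by (simp add: q_def algebra_simps)
  qed
  also have "q w h \<le> bloch_norm (T h)"
    unfolding q_def by (rule bloch_norm_ge[OF T_Bloch[OF h(1)] w(1)])
  also have "\<dots> \<le> bloch_norm (\<lambda>z. T h z - K h z) + bloch_norm (K h)"
    by (rule bloch_norm_triangle[OF T_Bloch[OF h(1)] K_Bloch[OF h(1)]])
  also have "bloch_norm (K h) < e / 2" unfolding Kh by (rule N) (auto simp: m_def)
  finally have "c \<le> bloch_norm (\<lambda>z. T h z - K h z) + e" using w qm by simp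
  then have "ennreal c \<le> ennreal (bloch_norm (\<lambda>z. T h z - K h z) + e)" by (rule ennreal_leI)
  also have "\<dots> = ennreal (bloch_norm (\<lambda>z. T h z - K h z)) + ennreal e"
    using e by (intro ennreal_plus bloch_norm_nonneg Bloch_diff T_Bloch K_Bloch h) auto
  also have "\<dots> \<le> ?N + ennreal e"
    unfolding operator_norm_def using h by (intro add_right_mono SUP_upper2[of h]) (auto simp: T_def)
  finally show "ennreal c \<le> ?N + ennreal e" .
qed

text \<open>P stands for either family of test functions. Scaling by 1/16 turns the bound 4 powr p
  on the means into the (1/4) powr p required above, and this is the constant lost.\<close>

lemma essential_norm_ge:
  assumes u: "u holomorphic_on \<D>" and \<phi>: "\<phi> holomorphic_on \<D>" "\<phi> ` \<D> \<subseteq> \<D>" and p: "1 \<le> p"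
    and T: "linear_map (Hardy p) Bloch (weighted_comp u \<phi>)"
    and P: "\<And>a. a \<in> \<D> \<Longrightarrow> P a \<in> analytic_disk"
      "\<And>a r. a \<in> \<D> \<Longrightarrow> 0 < r \<Longrightarrow> r < 1 \<Longrightarrow> hardy_mean p (P a) r \<le> 4 powr p"
      "\<And>a z. a \<in> \<D> \<Longrightarrow> z \<in> \<D> \<Longrightarrow> cmod (P a z) \<le> (1 - (cmod a)\<^sup>2) / (1 - cmod z) ^ 3"
  shows "ennreal (1 / 16) * limsup_boundary (\<lambda>a. a) (\<lambda>a. bloch_norm (weighted_comp u \<phi> (P a)))
    \<le> essential_norm (Hardy p) (hardy_norm p) Bloch bloch_norm (weighted_comp u \<phi>)"
  unfolding essential_norm_def
proof (rule INF_greatest, rule ccontr)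
  fix K assume "K \<in> {K. compact_operator (Hardy p) (hardy_norm p) Bloch bloch_norm K}"
  then have K: "compact_operator (Hardy p) (hardy_norm p) Bloch bloch_norm K" by simp
  let ?L = "limsup_boundary (\<lambda>a. a) (\<lambda>a. bloch_norm (weighted_comp u \<phi> (P a)))"
  let ?N = "operator_norm (Hardy p) (hardy_norm p) bloch_norm (\<lambda>f w. weighted_comp u \<phi> f w - K f w)"
  assume "\<not> ennreal (1 / 16) * ?L \<le> ?N"
  then have lt: "?N < ennreal (1 / 16) * ?L" by simp
  \<comment> \<open>Clearing the factor makes room for a finite c with ?N * 16 < c < ?L, even when
    ?L is infinite.\<close>
  have "?N * 16 < ?L"
  proof (rule ccontr)
    assume "\<not> ?N * 16 < ?L"
    then have "ennreal (1 / 16) * ?L \<le> ennreal (1 / 16) * (?N * 16)" by (intro mult_left_mono) auto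
    also have "\<dots> = (ennreal (1 / 16) * ennreal 16) * ?N" by (simp add: mult_ac del: ennreal_1)
    also have "ennreal (1 / 16) * ennreal 16 = 1" by (subst ennreal_mult[symmetric]) auto
    finally show False using lt by simp
  qed
  then obtain c' where c': "?N * 16 < c'" "c' < ?L" using dense by blast
  then obtain c where c: "c' = ennreal c" "0 \<le> c" by (cases c') auto
  have "\<exists>a. a \<in> \<D> \<and> 1 - 1 / real (Suc n) < cmod a \<and> c < bloch_norm (weighted_comp u \<phi> (P a))" for n
  proof -
    have "ennreal c < (SUP a\<in>{a \<in> \<D>. 1 - 1 / real (Suc n) < cmod a}. ennreal (bloch_norm (weighted_comp u \<phi> (P a))))"
      using c' c limsup_boundary_le[of "1 - 1 / real (Suc n)" "\<lambda>a. a" "\<lambda>a. bloch_norm (weighted_comp u \<phi> (P a))"]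
      by (auto intro: less_le_trans)
    then show ?thesis using c by (auto simp: less_SUP_iff ennreal_less_iff)
  qed
  then obtain a where a: "\<And>n. a n \<in> \<D>" "\<And>n. 1 - 1 / real (Suc n) < cmod (a n)"
    "\<And>n. c < bloch_norm (weighted_comp u \<phi> (P (a n)))" by metis
  define g where "g = (\<lambda>n z. (1 / 16) * P (a n) z)"
  have g1: "g n \<in> analytic_disk" for n unfolding g_def by (intro analytic_disk_cmult P a)
  have g2: "hardy_mean p (g n) r \<le> (1/4) powr p" if "0 < r" "r < 1" for n r
  proof -
    have "hardy_mean p (g n) r = (1/16) powr p * hardy_mean p (P (a n)) r"
      unfolding g_def hardy_mean_cmult by simp
    also have "\<dots> \<le> (1/16) powr p * 4 powr p" using that a P by (intro mult_left_mono) auto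
    also have "\<dots> = (1/16 * 4) powr p" by (simp only: powr_mult)
    finally show ?thesis by simp
  qed
  \<comment> \<open>The point a n is within 1 / (n + 1) of the unit circle, and 1 - |a|^2 is at most
    2 (1 - |a|); hence the numerator 2 / (n + 1).\<close>
  have g3: "cmod (g n z) \<le> (2 / real (Suc n)) / (1 - cmod z) ^ 3" if z: "z \<in> \<D>" for n z
  proof -
    have "cmod (g n z) \<le> cmod (P (a n) z)" by (simp add: g_def norm_mult)
    also have "\<dots> \<le> (1 - (cmod (a n))\<^sup>2) / (1 - cmod z) ^ 3" by (rule P(3)[OF a(1) z])
    also have "1 - (cmod (a n))\<^sup>2 \<le> 2 * (1 - cmod (a n))" using a(1)[of n] by (intro one_minus_norm_sq) simp
    also have "\<dots> \<le> 2 / real (Suc n)" using a(2)[of n] by simp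
    finally show ?thesis using z by (simp add: divide_right_mono)
  qed
  have gH: "g n \<in> Hardy p" for n using g1 g2 by (intro HardyI) auto
  have g4: "c / 16 \<le> bloch_norm (weighted_comp u \<phi> (g n))" for n
  proof -
    have "weighted_comp u \<phi> (g n) \<in> Bloch" using T gH by (auto simp: linear_map_def)
    from bloch_norm_cmult_le[OF this, of 16]
    have "bloch_norm (weighted_comp u \<phi> (P (a n))) \<le> 16 * bloch_norm (weighted_comp u \<phi> (g n))"
      unfolding weighted_comp_cmult[symmetric] by (simp add: g_def)
    then show ?thesis using a(3)[of n] by simp
  qed
  have "(\<lambda>n. 2 / real (Suc n)) \<longlonglongrightarrow> 0"
    using tendsto_mult[OF tendsto_const[of 2] LIMSEQ_Suc[OF lim_1_over_n]] by simp
  from compact_perturbation_lower_bound[where g = g, OF u \<phi> p T K g1 g2 g3 this g4]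
  have "ennreal (c / 16) \<le> ?N" by simp
  then have "ennreal (c / 16) * 16 \<le> ?N * 16" by (rule mult_right_mono) simp
  also have "ennreal (c / 16) * 16 = ennreal (c / 16) * ennreal 16" by simp
  also have "\<dots> = c'" using c by (subst ennreal_mult[symmetric]) auto
  finally show False using c' by simp
qed

subsection \<open>Recovering the symbol limits from the test functions\<close>

text \<open>For a = \<open>\<phi> z\<close> the images of the two test functions have derivatives X
  + 2Y and X + (2 + 1/p)Y at z, where X carries the derivative of u and Y the derivative of
  \<open>\<phi>\<close>. This linear system is solved for X and Y.\<close>

lemma limsup_le_test_limsups:
  assumes u: "u holomorphic_on \<D>" and \<phi>: "\<phi> holomorphic_on \<D>" "\<phi> ` \<D> \<subseteq> \<D>" and p: "1 \<le> p"
    and T: "\<And>a. a \<in> \<D> \<Longrightarrow> weighted_comp u \<phi> (test_p p a) \<in> Bloch"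
      "\<And>a. a \<in> \<D> \<Longrightarrow> weighted_comp u \<phi> (test_q p a) \<in> Bloch"
  shows "max (limsup_boundary \<phi>
        (\<lambda>z. (1 - (cmod z)\<^sup>2) * cmod (deriv u z) / (1 - (cmod (\<phi> z))\<^sup>2) powr (1 / p)))
      (limsup_boundary \<phi>
        (\<lambda>z. (1 - (cmod z)\<^sup>2) * cmod (u z * deriv \<phi> z) / (1 - (cmod (\<phi> z))\<^sup>2) powr ((1 + p) / p)))
    \<le> ennreal (5 * p) * (limsup_boundary (\<lambda>a. a) (\<lambda>a. bloch_norm (weighted_comp u \<phi> (test_p p a))) +
        limsup_boundary (\<lambda>a. a) (\<lambda>a. bloch_norm (weighted_comp u \<phi> (test_q p a))))"
proof -
  define F1 where "F1 = (\<lambda>z. (1 - (cmod z)\<^sup>2) * cmod (deriv u z) / (1 - (cmod (\<phi> z))\<^sup>2) powr (1 / p))"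
  define F2 where "F2 = (\<lambda>z. (1 - (cmod z)\<^sup>2) * cmod (u z * deriv \<phi> z) / (1 - (cmod (\<phi> z))\<^sup>2) powr ((1 + p) / p))"
  define N1 where "N1 = (\<lambda>a. bloch_norm (weighted_comp u \<phi> (test_p p a)))"
  define N2 where "N2 = (\<lambda>a. bloch_norm (weighted_comp u \<phi> (test_q p a)))"
  have N0: "0 \<le> N1 a" "0 \<le> N2 a" if "a \<in> \<D>" for a
    using T[OF that] by (simp_all add: N1_def N2_def bloch_norm_nonneg)
  have pw: "F1 z \<le> 5 * p * (N1 (\<phi> z) + N2 (\<phi> z)) \<and> F2 z \<le> 5 * p * (N1 (\<phi> z) + N2 (\<phi> z))"
    if z: "z \<in> \<D>" and big: "1 / 2 < cmod (\<phi> z)" for z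
  proof -
    define a where "a = \<phi> z"
    define b where "b = 1 - (cmod a)\<^sup>2"
    define v where "v = 1 - (cmod z)\<^sup>2"
    have a: "a \<in> \<D>" using \<phi>(2) z unfolding a_def by blast
    have v: "0 < v" using one_minus_norm_sq[of z] z by (simp add: v_def)
    have b: "0 < b" using one_minus_norm_sq[of a] a by (simp add: b_def)
    define X where "X = deriv u z * of_real (b powr (- 1 / p))"
    define Y where "Y = u z * deriv \<phi> z * cnj a * of_real (b powr (- 1 / p - 1))"
    have hol: "test_p p a holomorphic_on \<D>" "test_q p a holomorphic_on \<D>"
      using test_analytic[OF a] by (simp_all add: analytic_disk_def)
    have dp: "deriv (weighted_comp u \<phi> (test_p p a)) z = X + 2 * Y"
      unfolding deriv_weighted_comp[OF u \<phi> hol(1) z] a_def[symmetric] test_at[OF a p] b_def[symmetric] X_def Y_def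
      by (simp add: mult_ac)
    have dq: "deriv (weighted_comp u \<phi> (test_q p a)) z = X + of_real (2 + 1 / p) * Y"
      unfolding deriv_weighted_comp[OF u \<phi> hol(2) z] a_def[symmetric] test_at[OF a p] b_def[symmetric] X_def Y_def
      by (simp add: mult_ac)
    have n1: "v * cmod (X + 2 * Y) \<le> N1 a"
      using bloch_norm_ge[OF T(1)[OF a] z] norm_ge_zero[of "weighted_comp u \<phi> (test_p p a) 0"]
      unfolding dp N1_def v_def by linarith
    have n2: "v * cmod (X + of_real (2 + 1 / p) * Y) \<le> N2 a"
      using bloch_norm_ge[OF T(2)[OF a] z] norm_ge_zero[of "weighted_comp u \<phi> (test_q p a) 0"]
      unfolding dq N2_def v_def by linarith
    have f1: "F1 z = v * cmod X"
      using b by (simp add: F1_def X_def a_def[symmetric] b_def[symmetric] v_def[symmetric] norm_mult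
          norm_divide powr_minus_divide)
    have "(1 + p) / p = 1 / p + 1" using p by (simp add: field_simps)
    then have f2: "F2 z * cmod a = v * cmod Y"
      using b by (simp add: F2_def Y_def a_def[symmetric] b_def[symmetric] v_def[symmetric] norm_mult
          norm_divide powr_minus_divide powr_add powr_diff)
    have F20: "0 \<le> F2 z" using v by (simp add: F2_def v_def[symmetric])
    have Y1: "v * cmod Y \<le> p * (N1 a + N2 a)"
    proof -
      \<comment> \<open>The coefficients of Y differ by 1/p, which is where the factor p in the
        constant arises.\<close>
      have "of_real (1 / p) * Y = (X + of_real (2 + 1 / p) * Y) - (X + 2 * Y)" by (simp add: algebra_simps)
      then have "cmod (of_real (1 / p) * Y) \<le> cmod (X + of_real (2 + 1 / p) * Y) + cmod (X + 2 * Y)"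
        using norm_triangle_ineq4 by metis
      then have "1 / p * cmod Y \<le> cmod (X + of_real (2 + 1 / p) * Y) + cmod (X + 2 * Y)"
        using p by (simp only: norm_mult norm_of_real) simp
      then have "v * (1 / p * cmod Y) \<le> v * (cmod (X + of_real (2 + 1 / p) * Y) + cmod (X + 2 * Y))"
        using v by (intro mult_left_mono) auto
      also have "\<dots> \<le> N1 a + N2 a" using n1 n2 by (simp add: distrib_left)
      finally show ?thesis using p by (simp add: field_simps)
    qed
    \<comment> \<open>Y contains the factor cnj a, which degenerates at a = 0; restricting to |a| >
      1/2 limits the loss to a factor 2.\<close>
    have "F2 z * (1 / 2) \<le> F2 z * cmod a" using big F20 by (intro mult_left_mono) (auto simp: a_def)
    then have F2: "F2 z \<le> 2 * (p * (N1 a + N2 a))" using f2 Y1 by simp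
    have "X = (X + 2 * Y) - 2 * Y" by simp
    then have "cmod X \<le> cmod (X + 2 * Y) + cmod (2 * Y)" using norm_triangle_ineq4 by metis
    then have "v * cmod X \<le> v * (cmod (X + 2 * Y) + 2 * cmod Y)"
      using v by (intro mult_left_mono) (auto simp: norm_mult)
    then have F1: "F1 z \<le> N1 a + 2 * (p * (N1 a + N2 a))" using n1 Y1 f1 by (simp add: distrib_left)
    \<comment> \<open>Hence F1 is at most 3p and F2 at most 2p times N1 + N2, and 5p covers
      both.\<close>
    have "1 * (N1 a + N2 a) \<le> p * (N1 a + N2 a)" using p N0[OF a] by (intro mult_right_mono) auto
    then have "N1 a \<le> p * (N1 a + N2 a)" "0 \<le> p * (N1 a + N2 a)" using N0[OF a] by auto
    then show ?thesis using F1 F2 by (simp add: a_def)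
  qed
  define S where "S = (\<lambda>N s. SUP a\<in>{a \<in> \<D>. s < cmod a}. ennreal (N a))"
  let ?L = "\<lambda>N. limsup_boundary (\<lambda>a. a) N"
  have limS: "(S N \<longlongrightarrow> ?L N) (at_left 1)" for N
    unfolding S_def by (rule limsup_boundary_tendsto)
  have lim: "((\<lambda>s. ennreal (5 * p) * (S N1 s + S N2 s)) \<longlongrightarrow> ennreal (5 * p) * (?L N1 + ?L N2)) (at_left 1)"
    by (intro ennreal_tendsto_cmult tendsto_add limS) simp
  have main: "limsup_boundary \<phi> F \<le> ennreal (5 * p) * (?L N1 + ?L N2)"
    if F: "\<And>z. z \<in> \<D> \<Longrightarrow> 1 / 2 < cmod (\<phi> z) \<Longrightarrow> F z \<le> 5 * p * (N1 (\<phi> z) + N2 (\<phi> z))" for F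
  proof (rule tendsto_lowerbound[OF lim])
    show "\<forall>\<^sub>F s in at_left 1. limsup_boundary \<phi> F \<le> ennreal (5 * p) * (S N1 s + S N2 s)"
    proof -
      have "\<forall>\<^sub>F s in at_left (1::real). s \<in> {1/2<..<1}" by (rule eventually_at_left_real) simp
      then show ?thesis
      proof eventually_elim
        fix s :: real assume s: "s \<in> {1/2<..<1}"
        have "limsup_boundary \<phi> F \<le> (SUP z\<in>{z \<in> \<D>. s < cmod (\<phi> z)}. ennreal (F z))"
          using s by (intro limsup_boundary_le) auto
        also have "\<dots> \<le> ennreal (5 * p) * (S N1 s + S N2 s)"
        proof (rule SUP_least)
          fix z assume z: "z \<in> {z \<in> \<D>. s < cmod (\<phi> z)}"
          \<comment> \<open>The substitution a = \<open>\<phi> z\<close> sends this index set into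
            that of S N1 s and S N2 s, so the suprema can be compared for each s before s tends to
            1.\<close>
          then have d: "\<phi> z \<in> {a \<in> \<D>. s < cmod a}" using \<phi>(2) by blast
          have "ennreal (F z) \<le> ennreal (5 * p * (N1 (\<phi> z) + N2 (\<phi> z)))"
            using z s by (intro ennreal_leI F) auto
          also have "\<dots> = ennreal (5 * p) * (ennreal (N1 (\<phi> z)) + ennreal (N2 (\<phi> z)))"
            using p N0 d by (subst ennreal_mult) auto
          also have "\<dots> \<le> ennreal (5 * p) * (S N1 s + S N2 s)"
            unfolding S_def by (intro mult_left_mono add_mono SUP_upper d) auto
          finally show "ennreal (F z) \<le> ennreal (5 * p) * (S N1 s + S N2 s)" .
        qed
        finally show "limsup_boundary \<phi> F \<le> ennreal (5 * p) * (S N1 s + S N2 s)" .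
      qed
    qed
  qed simp
  show ?thesis
    unfolding F1_def[symmetric] F2_def[symmetric] N1_def[symmetric] N2_def[symmetric]
    using pw by (intro max.boundedI main) auto
qed

subsection \<open>The upper bound for the essential norm\<close>

definition dilation :: "real \<Rightarrow> (complex \<Rightarrow> complex) \<Rightarrow> complex \<Rightarrow> complex" where
  "dilation r f = on_disk (\<lambda>z. f (of_real r * z))"

lemma scaled_in_disk:
  assumes "0 < r" "r < 1" "z \<in> \<D>"
  shows "of_real r * z \<in> \<D>" "cmod (of_real r * z) \<le> cmod z" "cmod (of_real r * z) \<le> r"
proof -
  show 1: "cmod (of_real r * z) \<le> cmod z" using assms by (simp add: norm_mult mult_left_le_one_le)
  then show "of_real r * z \<in> \<D>" using assms by simp
  show "cmod (of_real r * z) \<le> r" using assms by (simp add: norm_mult mult_left_le)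
qed

lemma dilation_analytic:
  assumes "f holomorphic_on \<D>" "0 < r" "r < 1"
  shows "dilation r f \<in> analytic_disk"
  unfolding dilation_def
proof (rule on_disk_analytic)
  have img: "(\<lambda>z. of_real r * z) ` \<D> \<subseteq> \<D>"
    by (rule image_subsetI) (rule scaled_in_disk(1)[OF assms(2,3)])
  have "(\<lambda>z. of_real r * z) holomorphic_on \<D>" by (intro holomorphic_intros)
  from holomorphic_on_compose_gen[OF this assms(1) img]
  have "f \<circ> (\<lambda>z. of_real r * z) holomorphic_on \<D>" .
  then show "(\<lambda>z. f (of_real r * z)) holomorphic_on \<D>" by (simp add: o_def)
qed

lemma hardy_mean_le_bound:
  assumes f: "f holomorphic_on \<D>" and M: "\<And>z. z \<in> \<D> \<Longrightarrow> cmod (f z) \<le> M" and r: "0 < r" "r < 1" and p: "1 \<le> p"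
  shows "hardy_mean p f r \<le> M powr p"
proof -
  have "2 * pi * hardy_mean p f r \<le> integral {0..2 * pi} (\<lambda>t. M powr p)"
    unfolding integral_hardy_mean[symmetric]
  proof (rule integral_le)
    show "(\<lambda>t. cmod (f (of_real r * cis t)) powr p) integrable_on {0..2 * pi}"
      using f r p by (intro integrable_continuous_interval continuous_on_hardy_integrand) auto
    show "cmod (f (of_real r * cis t)) powr p \<le> M powr p" for t
      using r p by (intro powr_mono2 M) (auto simp: norm_mult)
  qed (rule integrable_const_ivl)
  also have "\<dots> = 2 * pi * M powr p" by simp
  finally show ?thesis by (rule mult_left_le_imp_le) simp
qed

text \<open>Circle means preserve uniform bounds. This later converts uniform convergence on the
  disk into convergence in the Hardy norm.\<close>

lemma bounded_Hardy:
  assumes f: "f \<in> analytic_disk" and M: "\<And>z. z \<in> \<D> \<Longrightarrow> cmod (f z) \<le> M" and p: "1 \<le> p"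
  shows "f \<in> Hardy p" "hardy_norm p f \<le> M"
proof -
  have hol: "f holomorphic_on \<D>" using f by (simp add: analytic_disk_def)
  have "cmod (f 0) \<le> M" using M by simp
  then have "0 \<le> M" by (rule order_trans[OF norm_ge_zero])
  then show "hardy_norm p f \<le> M"
    by (intro hardy_norm_leI hardy_mean_le_bound[OF hol M _ _ p] p)
  show "f \<in> Hardy p"
    by (rule HardyI[OF f hardy_mean_le_bound[OF hol M _ _ p]])
qed

lemma dilation_bounded:
  assumes f: "f holomorphic_on \<D>" and r: "0 < r" "r < 1"
  shows "\<exists>M. \<forall>z\<in>\<D>. cmod (dilation r f z) \<le> M"
proof -
  have "cball 0 r \<subseteq> \<D>" using r by auto
  then have "compact (f ` cball 0 r)"
    by (intro compact_continuous_image holomorphic_on_imp_continuous_on holomorphic_on_subset[OF f] compact_cball)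
  from compact_imp_bounded[OF this] obtain M where M: "\<forall>w\<in>f ` cball 0 r. cmod w \<le> M"
    unfolding bounded_iff by (rule exE)
  have "cmod (dilation r f z) \<le> M" if "z \<in> \<D>" for z
  proof -
    have "cmod (f (of_real r * z)) \<le> M"
      by (rule bspec[OF M imageI]) (use scaled_in_disk(3)[OF r that] in simp)
    then show ?thesis using that by (simp add: dilation_def on_disk_def)
  qed
  then show ?thesis by (intro exI ballI)
qed

lemma dilation_Hardy:
  assumes f: "f holomorphic_on \<D>" and r: "0 < r" "r < 1" and p: "1 \<le> p"
  shows "dilation r f \<in> Hardy p"
proof -
  obtain M where M: "\<forall>z\<in>\<D>. cmod (dilation r f z) \<le> M" using dilation_bounded[OF f r] by (rule exE)
  show ?thesis by (rule bounded_Hardy(1)[OF dilation_analytic[OF f r] bspec[OF M] p])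
qed

text \<open>The hypothesis of Montel's theorem: the bound in \<open>hardy_growth\<close> is
  continuous on the disk, hence bounded on compact subsets.\<close>

lemma unit_ball_locally_bounded:
  assumes "compact S" "S \<subseteq> \<D>" and p: "1 \<le> p"
  shows "\<exists>B. \<forall>h\<in>{f \<in> Hardy p. hardy_norm p f \<le> 1}. \<forall>z\<in>S. cmod (h z) \<le> B"
proof -
  have "(cmod z)\<^sup>2 \<noteq> 1" if "z \<in> S" for z
    using that assms(2) one_minus_norm_sq(3)[of z] by auto
  then have "continuous_on S (\<lambda>z. 8 * (1 - (cmod z)\<^sup>2) powr (- 1 / p))"
    by (intro continuous_intros) simp
  from compact_imp_bounded[OF compact_continuous_image[OF this assms(1)]]
  obtain B where B: "\<forall>x\<in>(\<lambda>z. 8 * (1 - (cmod z)\<^sup>2) powr (- 1 / p)) ` S. norm x \<le> B"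
    unfolding bounded_iff by (rule exE)
  have "cmod (h z) \<le> B" if "h \<in> Hardy p" "hardy_norm p h \<le> 1" "z \<in> S" for h z
  proof -
    have "cmod (h z) \<le> 8 * (1 - (cmod z)\<^sup>2) powr (- 1 / p)"
      using that assms by (intro hardy_growth) auto
    also have "\<dots> \<le> B" using bspec[OF B imageI[OF that(3)]] by simp
    finally show ?thesis .
  qed
  then show ?thesis by blast
qed

text \<open>Montel's theorem gives uniform convergence on \<open>cball 0 r\<close> along a
  subsequence. After dilation it is uniform on the whole disk, hence in the Hardy norm, and the
  bounded operator transports it to the Bloch norm.\<close>

lemma compact_operator_dilation:
  assumes T: "bounded_operator (Hardy p) (hardy_norm p) Bloch bloch_norm (weighted_comp u \<phi>)"
    and r: "0 < r" "r < 1" and p: "1 \<le> p"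
  shows "compact_operator (Hardy p) (hardy_norm p) Bloch bloch_norm (\<lambda>f. weighted_comp u \<phi> (dilation r f))"
proof -
  interpret B: Metric_space Bloch "norm_dist Bloch bloch_norm" by (rule Metric_space_Bloch)
  define K where "K = (\<lambda>f. weighted_comp u \<phi> (dilation r f))"
  define U where "U = {f \<in> Hardy p. hardy_norm p f \<le> 1}"
  have T_Bloch: "weighted_comp u \<phi> f \<in> Bloch" if "f \<in> Hardy p" for f
    using T that by (auto simp: bounded_operator_def linear_map_def)
  obtain B0 where B0: "\<And>f. f \<in> Hardy p \<Longrightarrow> bloch_norm (weighted_comp u \<phi> f) \<le> B0 * hardy_norm p f"
    using T by (auto simp: bounded_operator_def)
  define B where "B = \<bar>B0\<bar> + 1"
  have B1: "1 \<le> B" by (simp add: B_def)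
  have B: "bloch_norm (weighted_comp u \<phi> f) \<le> B * hardy_norm p f" if "f \<in> Hardy p" for f
  proof -
    have "B0 * hardy_norm p f \<le> B * hardy_norm p f"
      by (intro mult_right_mono hardy_norm_nonneg) (simp add: B_def)
    then show ?thesis using B0[OF that] by simp
  qed
  have K_Bloch: "K f \<in> Bloch" if "f \<in> Hardy p" for f
    unfolding K_def by (intro T_Bloch dilation_Hardy Hardy_holomorphic[OF that] r p)
  have lin: "linear_map (Hardy p) Bloch K"
    unfolding linear_map_def
  proof (intro conjI ballI allI)
    show "K ` Hardy p \<subseteq> Bloch" using K_Bloch by blast
  qed (auto simp: K_def weighted_comp_def dilation_def on_disk_def algebra_simps)
  let ?C = "B.mtopology closure_of (K ` U)"
  have "compactin B.mtopology ?C"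
    unfolding B.compactin_sequentially
  proof (intro conjI allI impI)
    show "?C \<subseteq> Bloch" using closure_of_subset_topspace[of B.mtopology "K ` U"] by simp
    fix \<sigma> :: "nat \<Rightarrow> complex \<Rightarrow> complex" assume \<sigma>: "range \<sigma> \<subseteq> ?C"
    then have \<sigma>C: "\<sigma> n \<in> ?C" for n by blast
    \<comment> \<open>The sequence lies in the closure of the image, so each term is first replaced
      by an exact image K f at distance less than 1 / (n + 1).\<close>
    have "\<exists>f\<in>U. norm_dist Bloch bloch_norm (\<sigma> n) (K f) < 1 / real (Suc n)" for n
    proof -
      have "\<forall>e>0. \<exists>y\<in>K ` U. y \<in> B.mball (\<sigma> n) e"
        using \<sigma>C[of n] unfolding B.metric_closure_of by simp
      from this[rule_format, of "1 / real (Suc n)"] show ?thesis by auto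
    qed
    then obtain f where f: "\<And>n. f n \<in> U" "\<And>n. norm_dist Bloch bloch_norm (\<sigma> n) (K (f n)) < 1 / real (Suc n)"
      by metis
    have fH: "f n \<in> Hardy p" for n using f(1) by (simp add: U_def)
    have \<sigma>B: "\<sigma> n \<in> Bloch" for n using \<sigma>C \<open>?C \<subseteq> Bloch\<close> by blast
    have Uhol: "\<And>h. h \<in> U \<Longrightarrow> h holomorphic_on \<D>" by (auto simp: U_def intro: Hardy_holomorphic[of _ p])
    have Ubd: "\<And>S. compact S \<Longrightarrow> S \<subseteq> \<D> \<Longrightarrow> \<exists>B. \<forall>h\<in>U. \<forall>z\<in>S. cmod (h z) \<le> B"
      unfolding U_def by (rule unit_ball_locally_bounded[OF _ _ p])
    have Urange: "range f \<subseteq> U" using f(1) by blast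
    obtain g k where g: "g holomorphic_on \<D>" and k: "strict_mono (k :: nat \<Rightarrow> nat)"
      and "\<And>x. x \<in> \<D> \<Longrightarrow> ((\<lambda>n. f (k n) x) \<longlongrightarrow> g x) sequentially"
      and ul: "\<And>S. \<lbrakk>compact S; S \<subseteq> \<D>\<rbrakk> \<Longrightarrow> uniform_limit S (f \<circ> k) g sequentially"
    proof (rule Montel[OF open_ball Uhol Ubd Urange])
      fix g k assume a: "g holomorphic_on \<D>" "strict_mono (k :: nat \<Rightarrow> nat)"
        "\<And>x. x \<in> \<D> \<Longrightarrow> ((\<lambda>n. f (k n) x) \<longlongrightarrow> g x) sequentially"
        "\<And>S. \<lbrakk>compact S; S \<subseteq> \<D>\<rbrakk> \<Longrightarrow> uniform_limit S (f \<circ> k) g sequentially"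
      show thesis by (rule that[OF a])
    qed
    \<comment> \<open>Montel's limit g is known only to be holomorphic; its dilation is bounded and
      therefore in \<open>Hardy p\<close>.\<close>
    define G where "G = dilation r g"
    have rD: "cball 0 r \<subseteq> \<D>" using r by auto
    have ul_r: "uniform_limit (cball 0 r) (f \<circ> k) g sequentially" using rD by (intro ul) auto
    have G_an: "G \<in> analytic_disk" unfolding G_def by (rule dilation_analytic[OF g r])
    have GH: "G \<in> Hardy p" unfolding G_def by (rule dilation_Hardy[OF g r p])
    let ?TG = "weighted_comp u \<phi> G"
    have TG: "?TG \<in> Bloch" by (rule T_Bloch[OF GH])
    have conv: "\<exists>N. \<forall>n\<ge>N. norm_dist Bloch bloch_norm (\<sigma> (k n)) ?TG < e" if e: "0 < e" for e
    proof -
      have "\<forall>\<^sub>F n in sequentially. \<forall>z\<in>cball 0 r. dist ((f \<circ> k) n z) (g z) < e / (2 * B)"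
        using e B1 by (intro uniform_limitD[OF ul_r]) simp
      then obtain N1 where N1: "\<forall>n\<ge>N1. \<forall>z\<in>cball 0 r. dist (f (k n) z) (g z) < e / (2 * B)"
        unfolding eventually_sequentially o_def by (rule exE)
      obtain N2 where N2: "1 / real (Suc N2) < e / 2" using e nat_approx_posE[of "e / 2"] by auto
      have "norm_dist Bloch bloch_norm (\<sigma> (k n)) ?TG < e" if n: "n \<ge> max N1 N2" for n
      proof -
        define d where "d = (\<lambda>z. dilation r (f (k n)) z - G z)"
        have dH: "d \<in> analytic_disk"
          unfolding d_def using fH by (intro analytic_disk_diff G_an dilation_analytic r Hardy_holomorphic)
        have db: "cmod (d z) \<le> e / (2 * B)" if z: "z \<in> \<D>" for z
        proof -
          have "d z = f (k n) (of_real r * z) - g (of_real r * z)"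
            using z by (simp add: d_def G_def dilation_def on_disk_def)
          then show ?thesis
            using N1[rule_format, of n "of_real r * z"] n scaled_in_disk(3)[OF r z] by (simp add: dist_norm)
        qed
        have "norm_dist Bloch bloch_norm (K (f (k n))) ?TG = bloch_norm (weighted_comp u \<phi> d)"
          using K_Bloch[OF fH[of "k n"]] TG by (simp add: norm_dist_def d_def weighted_comp_diff K_def)
        also have "\<dots> \<le> B * hardy_norm p d" by (rule B[OF bounded_Hardy(1)[OF dH db p]])
        also have "\<dots> \<le> B * (e / (2 * B))" using B1 by (intro mult_left_mono bounded_Hardy(2)[OF dH db p]) auto
        also have "\<dots> = e / 2" using B1 by simp
        finally have 1: "norm_dist Bloch bloch_norm (K (f (k n))) ?TG \<le> e / 2" .
        have "N2 \<le> k n" using n seq_suble[OF k, of n] by simp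
        then have "1 / real (Suc (k n)) \<le> 1 / real (Suc N2)" by (simp add: frac_le)
        then have "norm_dist Bloch bloch_norm (\<sigma> (k n)) (K (f (k n))) < e / 2"
          using f(2)[of "k n"] N2 by linarith
        then show ?thesis
          using B.triangle[OF \<sigma>B K_Bloch[OF fH] TG, of "k n" "k n"] 1 by linarith
      qed
      then show ?thesis by blast
    qed
    have lim: "limitin B.mtopology (\<sigma> \<circ> k) ?TG sequentially"
      unfolding B.limit_metric_sequentially using TG \<sigma>B conv by (auto simp: o_def)
    have "?TG \<in> ?C"
      by (rule limitin_closedin[OF lim closedin_closure_of]) (use \<sigma>C in auto)
    then show "\<exists>l r. l \<in> ?C \<and> strict_mono (r :: nat \<Rightarrow> nat) \<and> limitin B.mtopology (\<sigma> \<circ> r) l sequentially"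
      using k lim by blast
  qed
  then show ?thesis
    using lin by (simp add: compact_operator_def norm_topology_def K_def U_def)
qed

section \<open>Error of the approximation by dilations\<close>

lemma dilation_error_growth:
  assumes f: "f \<in> Hardy p" "hardy_norm p f \<le> 1" and r: "0 < r" "r < 1" and p: "1 \<le> p" and w: "w \<in> \<D>"
  shows "cmod (f w - dilation r f w) \<le> 16 * (1 - (cmod w)\<^sup>2) powr (- (1 / p))"
    and "cmod (deriv (\<lambda>z. f z - dilation r f z) w) \<le> 256 * (1 - (cmod w)\<^sup>2) powr (- (1 / p) - 1)"
proof -
  have hol: "f holomorphic_on \<D>" by (rule Hardy_holomorphic[OF f(1)])
  have bound: "cmod (f z - dilation r f z) \<le> 16 * (1 - (cmod z)\<^sup>2) powr (- (1 / p))" if z: "z \<in> \<D>" for z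
  proof -
    \<comment> \<open>Since |r z| is at most |z|, the dilation obeys the growth bound of f uniformly
      in r, which doubles 8 to 16. \<open>deriv_growth\<close> then contributes another 16, giving
      256.\<close>
    have "cmod (f (of_real r * z)) \<le> 8 * (1 - (cmod (of_real r * z))\<^sup>2) powr (- 1 / p)"
      by (rule hardy_growth[OF f scaled_in_disk(1)[OF r z] p])
    also have "\<dots> \<le> 8 * (1 - (cmod z)\<^sup>2) powr (- 1 / p)"
      using one_minus_norm_sq(3)[of z] z p power_mono[OF scaled_in_disk(2)[OF r z], of 2]
      by (intro mult_left_mono powr_mono2') auto
    finally have "cmod (f z) + cmod (f (of_real r * z)) \<le> 16 * (1 - (cmod z)\<^sup>2) powr (- 1 / p)"
      using hardy_growth[OF f z p] by simp
    then show ?thesis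
      using z norm_triangle_ineq4[of "f z" "f (of_real r * z)"] by (simp add: dilation_def on_disk_def)
  qed
  show "cmod (f w - dilation r f w) \<le> 16 * (1 - (cmod w)\<^sup>2) powr (- (1 / p))" by (rule bound[OF w])
  have hol': "(\<lambda>z. f z - dilation r f z) holomorphic_on \<D>"
    using dilation_analytic[OF hol r] by (intro holomorphic_on_diff hol) (simp add: analytic_disk_def)
  have "cmod (deriv (\<lambda>z. f z - dilation r f z) w) \<le> 16 * 16 * (1 - (cmod w)\<^sup>2) powr (- (1 / p) - 1)"
    using p by (intro deriv_growth[OF hol' _ _ _ bound w]) simp_all
  then show "cmod (deriv (\<lambda>z. f z - dilation r f z) w) \<le> 256 * (1 - (cmod w)\<^sup>2) powr (- (1 / p) - 1)"
    by simp
qed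

text \<open>With t between s and 1, the derivative of f is bounded by D on |z| at most t, and z and
  r z are at distance at most 1 - r, so the mean value inequality bounds the difference there.
  Cauchy's estimate with radius t - s bounds its derivative on the smaller disk.\<close>

lemma dilation_error_small:
  assumes s: "0 \<le> s" "s < 1" and p: "1 \<le> p"
  shows "\<exists>C\<ge>0. \<forall>f r w. f \<in> Hardy p \<longrightarrow> hardy_norm p f \<le> 1 \<longrightarrow> 0 < r \<longrightarrow> r < 1 \<longrightarrow> cmod w \<le> s \<longrightarrow>
    cmod (f w - dilation r f w) \<le> C * (1 - r) \<and> cmod (deriv (\<lambda>z. f z - dilation r f z) w) \<le> C * (1 - r)"
proof -
  define t where "t = (1 + s) / 2"
  have t: "s < t" "t < 1" "0 < t" using s by (auto simp: t_def)
  define D where "D = 128 * (1 - t\<^sup>2) powr (- (1 / p) - 1)"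
  have p': "- (1 / p) - 1 \<le> 0" using divide_nonneg_nonneg[of 1 p] p by linarith
  have D0: "0 \<le> D" by (simp add: D_def)
  have t2: "0 < 1 - t\<^sup>2" using t by (simp add: abs_square_less_1)
  have main: "cmod (f w - dilation r f w) \<le> D * (1 - r) \<and>
      cmod (deriv (\<lambda>z. f z - dilation r f z) w) \<le> D * (1 - r) / (t - s)"
    if f: "f \<in> Hardy p" "hardy_norm p f \<le> 1" and r: "0 < r" "r < 1" and w: "cmod w \<le> s" for f r w
  proof -
    have hol: "f holomorphic_on \<D>" by (rule Hardy_holomorphic[OF f(1)])
    have growth: "cmod (f z) \<le> 8 * (1 - (cmod z)\<^sup>2) powr (- (1 / p))" if "z \<in> \<D>" for z
      using hardy_growth[OF f that p] by simp
    have f': "cmod (deriv f z) \<le> D" if z: "z \<in> cball 0 t" for z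
    proof -
      have zD: "z \<in> \<D>" using z t by simp
      have "cmod (deriv f z) \<le> 16 * 8 * (1 - (cmod z)\<^sup>2) powr (- (1 / p) - 1)"
        using p by (intro deriv_growth[OF hol _ _ _ growth zD]) simp_all
      also have "\<dots> \<le> 16 * 8 * (1 - t\<^sup>2) powr (- (1 / p) - 1)"
        using z t t2 power_mono[of "cmod z" t 2] by (intro mult_left_mono powr_mono2' p') auto
      finally show ?thesis by (simp add: D_def)
    qed
    have diff: "cmod (f z - dilation r f z) \<le> D * (1 - r)" if z: "cmod z \<le> t" for z
    proof -
      have zD: "z \<in> \<D>" using z t by simp
      have rz: "of_real r * z \<in> cball 0 t" using scaled_in_disk(2)[OF r zD] z by simp
      have df: "(f has_field_derivative deriv f x) (at x within cball 0 t)" if "x \<in> cball 0 t" for x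
        by (rule has_field_derivative_at_within, rule holomorphic_derivI[OF hol open_ball]) (use that t in auto)
      have "cmod (f z - f (of_real r * z)) \<le> D * cmod (z - of_real r * z)"
        using z by (intro field_differentiable_bound[OF convex_cball df f' _ rz]) simp_all
      also have "z - of_real r * z = of_real (1 - r) * z" by (simp add: algebra_simps)
      also have "D * cmod (of_real (1 - r) * z) = D * ((1 - r) * cmod z)"
        unfolding norm_mult norm_of_real using r by simp
      also have "\<dots> \<le> D * (1 - r)" using zD r D0 by (intro mult_left_mono) (auto simp: mult_left_le)
      finally show ?thesis using zD by (simp add: dilation_def on_disk_def)
    qed
    have "(\<lambda>z. f z - dilation r f z) holomorphic_on \<D>"
      using dilation_analytic[OF hol r] by (intro holomorphic_on_diff hol) (simp add: analytic_disk_def)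
    then have "cmod (deriv (\<lambda>z. f z - dilation r f z) w) \<le> D * (1 - r) / (t - s)"
      by (rule deriv_bound) (use w t diff in auto)
    moreover have "cmod (f w - dilation r f w) \<le> D * (1 - r)" using w t by (intro diff) simp
    ultimately show ?thesis by blast
  qed
  define C where "C = D + D / (t - s)"
  have D1: "0 \<le> D / (t - s)" using D0 t by simp
  then have C0: "0 \<le> C" using D0 by (simp add: C_def)
  have bound: "cmod (f w - dilation r f w) \<le> C * (1 - r) \<and> cmod (deriv (\<lambda>z. f z - dilation r f z) w) \<le> C * (1 - r)"
    if "f \<in> Hardy p" "hardy_norm p f \<le> 1" and r: "0 < r" "r < 1" and "cmod w \<le> s" for f r w
  proof -
    have "0 \<le> D * (1 - r)" "0 \<le> D / (t - s) * (1 - r)"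
      using D0 D1 r by (intro mult_nonneg_nonneg; simp)+
    then show ?thesis using main[OF that] by (simp add: C_def distrib_right)
  qed
  show ?thesis
    by (rule exI[of _ C], rule conjI[OF C0], intro allI impI, rule bound)
qed

text \<open>Test on the functions 1 and z. The first image has the derivative of u as its
  derivative; subtracting \<open>\<phi>\<close> times this from the derivative of the second leaves
  u times the derivative of \<open>\<phi>\<close>, and |\<open>\<phi>\<close>| < 1.\<close>

lemma bounded_operator_symbol_bounds:
  assumes u: "u holomorphic_on \<D>" and \<phi>: "\<phi> holomorphic_on \<D>" "\<phi> ` \<D> \<subseteq> \<D>" and p: "1 \<le> p"
    and T: "linear_map (Hardy p) Bloch (weighted_comp u \<phi>)"
  shows "\<exists>\<beta>\<ge>0. \<forall>z\<in>\<D>. (1 - (cmod z)\<^sup>2) * cmod (deriv u z) \<le> \<beta> \<and> (1 - (cmod z)\<^sup>2) * cmod (u z * deriv \<phi> z) \<le> \<beta>"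
proof -
  define f0 where "f0 = on_disk (\<lambda>z. 1)"
  define f1 where "f1 = on_disk (\<lambda>z. z)"
  have an: "f0 \<in> analytic_disk" "f1 \<in> analytic_disk"
    unfolding f0_def f1_def by (intro on_disk_analytic holomorphic_intros)+
  then have hol: "f0 holomorphic_on \<D>" "f1 holomorphic_on \<D>" by (simp_all add: analytic_disk_def)
  have "f0 \<in> Hardy p" by (rule bounded_Hardy(1)[OF an(1) _ p, of 1]) (simp add: f0_def on_disk_def)
  then have B0: "weighted_comp u \<phi> f0 \<in> Bloch" using T by (auto simp: linear_map_def)
  have "f1 \<in> Hardy p" by (rule bounded_Hardy(1)[OF an(2) _ p, of 1]) (simp add: f1_def on_disk_def)
  then have B1: "weighted_comp u \<phi> f1 \<in> Bloch" using T by (auto simp: linear_map_def)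
  define b0 where "b0 = bloch_norm (weighted_comp u \<phi> f0)"
  define b1 where "b1 = bloch_norm (weighted_comp u \<phi> f1)"
  have b: "0 \<le> b0" "0 \<le> b1" using B0 B1 by (simp_all add: b0_def b1_def bloch_norm_nonneg)
  have "(1 - (cmod z)\<^sup>2) * cmod (deriv u z) \<le> b0 + b1 \<and> (1 - (cmod z)\<^sup>2) * cmod (u z * deriv \<phi> z) \<le> b0 + b1"
    if z: "z \<in> \<D>" for z
  proof -
    define v where "v = 1 - (cmod z)\<^sup>2"
    have v: "0 < v" using one_minus_norm_sq[of z] z by (simp add: v_def)
    have \<phi>z: "\<phi> z \<in> \<D>" using \<phi>(2) z by blast
    have d0: "deriv f0 (\<phi> z) = 0" unfolding f0_def deriv_on_disk[OF \<phi>z] by simp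
    have d1: "deriv f1 (\<phi> z) = 1" unfolding f1_def deriv_on_disk[OF \<phi>z] by simp
    have v0: "f0 (\<phi> z) = 1" "f1 (\<phi> z) = \<phi> z" unfolding f0_def f1_def on_disk_eq[OF \<phi>z] by simp_all
    have e0: "deriv (weighted_comp u \<phi> f0) z = deriv u z"
      unfolding deriv_weighted_comp[OF u \<phi> hol(1) z] d0 v0 by simp
    have e1: "deriv (weighted_comp u \<phi> f1) z = deriv u z * \<phi> z + u z * deriv \<phi> z"
      unfolding deriv_weighted_comp[OF u \<phi> hol(2) z] d1 v0 by simp
    have 1: "v * cmod (deriv u z) \<le> b0"
      using bloch_norm_ge[OF B0 z] norm_ge_zero[of "weighted_comp u \<phi> f0 0"]
      unfolding e0 b0_def v_def by linarith
    have 2: "v * cmod (deriv u z * \<phi> z + u z * deriv \<phi> z) \<le> b1"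
      using bloch_norm_ge[OF B1 z] norm_ge_zero[of "weighted_comp u \<phi> f1 0"]
      unfolding e1 b1_def v_def by linarith
    have "cmod (u z * deriv \<phi> z) \<le> cmod (deriv u z * \<phi> z + u z * deriv \<phi> z) + cmod (deriv u z * \<phi> z)"
      using norm_triangle_ineq4[of "deriv u z * \<phi> z + u z * deriv \<phi> z" "deriv u z * \<phi> z"] by simp
    also have "cmod (deriv u z * \<phi> z) \<le> cmod (deriv u z)"
      using \<phi>z by (simp add: norm_mult mult_left_le)
    finally have "v * cmod (u z * deriv \<phi> z) \<le> v * (cmod (deriv u z * \<phi> z + u z * deriv \<phi> z) + cmod (deriv u z))"
      using v by (intro mult_left_mono) auto
    then show ?thesis using 1 2 b unfolding v_def by (simp add: distrib_left)
  qed
  then show ?thesis using b by (intro exI[of _ "b0 + b1"]) auto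
qed

text \<open>The approximation error is split at |\<open>\<phi> z\<close>| = s. Beyond s the growth
  bounds give 16 F1 and 256 F2 uniformly in r; elsewhere the error is O(1 - r) and vanishes as r
  tends to 1.\<close>

lemma essential_norm_le_sup:
  assumes u: "u holomorphic_on \<D>" and \<phi>: "\<phi> holomorphic_on \<D>" "\<phi> ` \<D> \<subseteq> \<D>" and p: "1 \<le> p"
    and T: "bounded_operator (Hardy p) (hardy_norm p) Bloch bloch_norm (weighted_comp u \<phi>)"
    and s: "0 < s" "s < 1"
  shows "essential_norm (Hardy p) (hardy_norm p) Bloch bloch_norm (weighted_comp u \<phi>) \<le> ennreal 256 *
    ((SUP z\<in>{z \<in> \<D>. s < cmod (\<phi> z)}.
        ennreal ((1 - (cmod z)\<^sup>2) * cmod (deriv u z) / (1 - (cmod (\<phi> z))\<^sup>2) powr (1 / p))) +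
     (SUP z\<in>{z \<in> \<D>. s < cmod (\<phi> z)}.
        ennreal ((1 - (cmod z)\<^sup>2) * cmod (u z * deriv \<phi> z) / (1 - (cmod (\<phi> z))\<^sup>2) powr ((1 + p) / p))))"
proof -
  define F1 where "F1 = (\<lambda>z. (1 - (cmod z)\<^sup>2) * cmod (deriv u z) / (1 - (cmod (\<phi> z))\<^sup>2) powr (1 / p))"
  define F2 where "F2 = (\<lambda>z. (1 - (cmod z)\<^sup>2) * cmod (u z * deriv \<phi> z) / (1 - (cmod (\<phi> z))\<^sup>2) powr ((1 + p) / p))"
  define S1 where "S1 = (SUP z\<in>{z \<in> \<D>. s < cmod (\<phi> z)}. ennreal (F1 z))"
  define S2 where "S2 = (SUP z\<in>{z \<in> \<D>. s < cmod (\<phi> z)}. ennreal (F2 z))"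
  let ?E = "essential_norm (Hardy p) (hardy_norm p) Bloch bloch_norm (weighted_comp u \<phi>)"
  have lin: "linear_map (Hardy p) Bloch (weighted_comp u \<phi>)" using T by (simp add: bounded_operator_def)
  have "?E \<le> ennreal 256 * (S1 + S2)"
  proof (cases "S1 = top \<or> S2 = top")
    case True
    then show ?thesis by (auto simp: ennreal_mult_top)
  next
    case False
    then obtain x1 x2 where x1: "S1 = ennreal x1" "0 \<le> x1" and x2: "S2 = ennreal x2" "0 \<le> x2"
      by (cases S1; cases S2) auto
    have F1x: "F1 z \<le> x1" and F2x: "F2 z \<le> x2" if "z \<in> \<D>" "s < cmod (\<phi> z)" for z
    proof -
      have "ennreal (F1 z) \<le> S1" unfolding S1_def using that by (intro SUP_upper) simp
      then show "F1 z \<le> x1" using x1 by simp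
      have "ennreal (F2 z) \<le> S2" unfolding S2_def using that by (intro SUP_upper) simp
      then show "F2 z \<le> x2" using x2 by simp
    qed
    obtain \<beta> where \<beta>0: "0 \<le> \<beta>" and \<beta>: "\<forall>z\<in>\<D>. (1 - (cmod z)\<^sup>2) * cmod (deriv u z) \<le> \<beta> \<and> (1 - (cmod z)\<^sup>2) * cmod (u z * deriv \<phi> z) \<le> \<beta>"
      using bounded_operator_symbol_bounds[OF u \<phi> p lin] by blast
    \<comment> \<open>Including |\<open>\<phi> 0\<close>| lets the same smallness estimate handle
      the value at 0 in the Bloch norm.\<close>
    define t where "t = max s (cmod (\<phi> 0))"
    have \<phi>D: "\<phi> z \<in> \<D>" if "z \<in> \<D>" for z using \<phi>(2) that by blast
    have t: "0 \<le> t" "t < 1" "s \<le> t" "cmod (\<phi> 0) \<le> t" using s \<phi>D[of 0] by (auto simp: t_def)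
    obtain C where C0: "0 \<le> C" and C: "\<forall>f r w. f \<in> Hardy p \<longrightarrow> hardy_norm p f \<le> 1 \<longrightarrow> 0 < r \<longrightarrow> r < 1 \<longrightarrow> cmod w \<le> t \<longrightarrow>
      cmod (f w - dilation r f w) \<le> C * (1 - r) \<and> cmod (deriv (\<lambda>z. f z - dilation r f z) w) \<le> C * (1 - r)"
      using dilation_error_small[OF t(1,2) p] by blast
    \<comment> \<open>|u 0| comes from the value at 0, and one \<open>\<beta>\<close> from each term
      of the derivative.\<close>
    define Q where "Q = (cmod (u 0) + 2 * \<beta>) * C"
    have Q0: "0 \<le> Q" using C0 \<beta>0 by (simp add: Q_def)
    have err: "bloch_norm (weighted_comp u \<phi> (\<lambda>z. f z - dilation r f z)) \<le> 256 * (x1 + x2) + Q * (1 - r)"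
      if f: "f \<in> Hardy p" "hardy_norm p f \<le> 1" and r: "0 < r" "r < 1" for f r
    proof (rule bloch_norm_le)
      fix z assume z: "z \<in> \<D>"
      define h where "h = (\<lambda>z. f z - dilation r f z)"
      have hol: "h holomorphic_on \<D>"
        unfolding h_def using dilation_analytic[OF Hardy_holomorphic[OF f(1)] r]
        by (intro holomorphic_on_diff Hardy_holomorphic[OF f(1)]) (simp add: analytic_disk_def)
      define v where "v = 1 - (cmod z)\<^sup>2"
      have v: "0 < v" using one_minus_norm_sq[of z] z by (simp add: v_def)
      define b where "b = 1 - (cmod (\<phi> z))\<^sup>2"
      have b: "0 < b" using one_minus_norm_sq[of "\<phi> z"] \<phi>D[OF z] by (simp add: b_def)
      have small: "cmod (h w) \<le> C * (1 - r)" "cmod (deriv h w) \<le> C * (1 - r)" if "cmod w \<le> t" for w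
        using C[rule_format, OF f r that] unfolding h_def by blast+
      have "cmod (weighted_comp u \<phi> h 0) = cmod (u 0) * cmod (h (\<phi> 0))"
        by (simp add: weighted_comp_def on_disk_def norm_mult)
      also have "\<dots> \<le> cmod (u 0) * (C * (1 - r))" using small t by (intro mult_left_mono) auto
      finally have 0: "cmod (weighted_comp u \<phi> h 0) \<le> cmod (u 0) * (C * (1 - r))" .
      have "cmod (deriv (weighted_comp u \<phi> h) z) \<le>
          cmod (deriv u z) * cmod (h (\<phi> z)) + cmod (u z * deriv \<phi> z) * cmod (deriv h (\<phi> z))"
        unfolding deriv_weighted_comp[OF u \<phi> hol z]
        using norm_triangle_ineq[of "deriv u z * h (\<phi> z)" "u z * deriv \<phi> z * deriv h (\<phi> z)"]
        by (simp add: norm_mult)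
      then have "v * cmod (deriv (weighted_comp u \<phi> h) z) \<le>
          v * (cmod (deriv u z) * cmod (h (\<phi> z)) + cmod (u z * deriv \<phi> z) * cmod (deriv h (\<phi> z)))"
        using v by (intro mult_left_mono) auto
      also have "\<dots> = (v * cmod (deriv u z)) * cmod (h (\<phi> z)) + (v * cmod (u z * deriv \<phi> z)) * cmod (deriv h (\<phi> z))"
        by (simp add: algebra_simps)
      also have "\<dots> \<le> 256 * (x1 + x2) + 2 * \<beta> * (C * (1 - r))"
      proof (cases "s < cmod (\<phi> z)")
        case True
        have exponent: "(1 + p) / p = 1 / p + 1" using p by (simp add: field_simps)
        have "(v * cmod (deriv u z)) * cmod (h (\<phi> z)) \<le> (v * cmod (deriv u z)) * (16 * b powr (- (1 / p)))"
          unfolding h_def b_def using v dilation_error_growth(1)[OF f r p \<phi>D[OF z]] by (intro mult_left_mono) auto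
        also have "\<dots> = 16 * F1 z"
          using b by (simp add: F1_def b_def[symmetric] v_def[symmetric] powr_minus_divide)
        also have "\<dots> \<le> 16 * x1" using F1x[OF z True] by simp
        finally have 1: "(v * cmod (deriv u z)) * cmod (h (\<phi> z)) \<le> 16 * x1" .
        have "(v * cmod (u z * deriv \<phi> z)) * cmod (deriv h (\<phi> z))
            \<le> (v * cmod (u z * deriv \<phi> z)) * (256 * b powr (- (1 / p) - 1))"
          unfolding h_def b_def using v dilation_error_growth(2)[OF f r p \<phi>D[OF z]] by (intro mult_left_mono) auto
        also have "\<dots> = 256 * F2 z"
          using b by (simp add: F2_def exponent b_def[symmetric] v_def[symmetric] powr_minus_divide powr_add powr_diff)
        also have "\<dots> \<le> 256 * x2" using F2x[OF z True] by simp
        finally have 2: "(v * cmod (u z * deriv \<phi> z)) * cmod (deriv h (\<phi> z)) \<le> 256 * x2" .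
        have "0 \<le> 2 * \<beta> * (C * (1 - r))" using \<beta>0 C0 r by simp
        then show ?thesis using 1 2 x1 unfolding distrib_left by linarith
      next
        case False
        then have le: "cmod (\<phi> z) \<le> t" using t by simp
        have "(v * cmod (deriv u z)) * cmod (h (\<phi> z)) \<le> \<beta> * (C * (1 - r))"
          using \<beta> z v small(1)[OF le] \<beta>0 unfolding v_def by (intro mult_mono) auto
        moreover have "(v * cmod (u z * deriv \<phi> z)) * cmod (deriv h (\<phi> z)) \<le> \<beta> * (C * (1 - r))"
          using \<beta> z v small(2)[OF le] \<beta>0 unfolding v_def by (intro mult_mono) auto
        ultimately show ?thesis using x1 x2 by simp
      qed
      finally have "v * cmod (deriv (weighted_comp u \<phi> h) z) \<le> 256 * (x1 + x2) + 2 * \<beta> * (C * (1 - r))" .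
      then have "cmod (weighted_comp u \<phi> h 0) + v * cmod (deriv (weighted_comp u \<phi> h) z)
          \<le> 256 * (x1 + x2) + Q * (1 - r)"
        using 0 by (simp add: Q_def algebra_simps)
      then show "cmod (weighted_comp u \<phi> (\<lambda>z. f z - dilation r f z) 0) +
          (1 - (cmod z)\<^sup>2) * cmod (deriv (weighted_comp u \<phi> (\<lambda>z. f z - dilation r f z)) z)
          \<le> 256 * (x1 + x2) + Q * (1 - r)"
        by (simp only: h_def v_def)
    qed
    show ?thesis
    proof (rule ennreal_le_epsilon)
      fix e :: real assume e: "0 < e"
      \<comment> \<open>d = 1 - r is chosen so that Q * d is at most e; Q + 1 keeps the denominator
        positive and 1/2 keeps r positive.\<close>
      define d where "d = min (1 / 2) (e / (Q + 1))"
      have d: "0 < d" "d < 1" using e Q0 by (auto simp: d_def)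
      have "Q * d \<le> (Q + 1) * (e / (Q + 1))" using d Q0 e by (intro mult_mono) (auto simp: d_def)
      then have Qd: "Q * d \<le> e" using Q0 by simp
      define r where "r = 1 - d"
      have r: "0 < r" "r < 1" using d by (auto simp: r_def)
      have K: "compact_operator (Hardy p) (hardy_norm p) Bloch bloch_norm (\<lambda>f. weighted_comp u \<phi> (dilation r f))"
        by (rule compact_operator_dilation[OF T r p])
      have "?E \<le> operator_norm (Hardy p) (hardy_norm p) bloch_norm
          (\<lambda>f w. weighted_comp u \<phi> f w - weighted_comp u \<phi> (dilation r f) w)"
        unfolding essential_norm_def by (rule INF_lower2[of "\<lambda>f. weighted_comp u \<phi> (dilation r f)"]) (use K in auto)
      also have "\<dots> \<le> ennreal (256 * (x1 + x2) + Q * d)"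
        unfolding operator_norm_def weighted_comp_diff[symmetric]
      proof (rule SUP_least)
        fix f assume "f \<in> {f \<in> Hardy p. hardy_norm p f \<le> 1}"
        then show "ennreal (bloch_norm (weighted_comp u \<phi> (\<lambda>z. f z - dilation r f z))) \<le> ennreal (256 * (x1 + x2) + Q * d)"
          using err[of f r] r by (intro ennreal_leI) (simp add: r_def)
      qed
      also have "\<dots> \<le> ennreal (256 * (x1 + x2) + e)" using Qd by (intro ennreal_leI) simp
      also have "\<dots> = ennreal 256 * (S1 + S2) + ennreal e"
        using x1 x2 e by (simp add: ennreal_mult distrib_left del: ennreal_numeral)
      finally show "?E \<le> ennreal 256 * (S1 + S2) + ennreal e" .
    qed
  qed
  then show ?thesis by (simp only: S1_def S2_def F1_def F2_def)
qed

lemma essential_norm_le_limsups: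
  assumes u: "u holomorphic_on \<D>" and \<phi>: "\<phi> holomorphic_on \<D>" "\<phi> ` \<D> \<subseteq> \<D>" and p: "1 \<le> p"
    and T: "bounded_operator (Hardy p) (hardy_norm p) Bloch bloch_norm (weighted_comp u \<phi>)"
  shows "essential_norm (Hardy p) (hardy_norm p) Bloch bloch_norm (weighted_comp u \<phi>) \<le> ennreal 256 *
    (limsup_boundary \<phi>
        (\<lambda>z. (1 - (cmod z)\<^sup>2) * cmod (deriv u z) / (1 - (cmod (\<phi> z))\<^sup>2) powr (1 / p)) +
     limsup_boundary \<phi>
        (\<lambda>z. (1 - (cmod z)\<^sup>2) * cmod (u z * deriv \<phi> z) / (1 - (cmod (\<phi> z))\<^sup>2) powr ((1 + p) / p)))"
proof (rule tendsto_lowerbound)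
  have "\<forall>\<^sub>F s in at_left (1::real). s \<in> {0<..<1}" by (rule eventually_at_left_real) simp
  then show "\<forall>\<^sub>F s in at_left 1. essential_norm (Hardy p) (hardy_norm p) Bloch bloch_norm (weighted_comp u \<phi>) \<le> ennreal 256 *
    ((SUP z\<in>{z \<in> \<D>. s < cmod (\<phi> z)}.
        ennreal ((1 - (cmod z)\<^sup>2) * cmod (deriv u z) / (1 - (cmod (\<phi> z))\<^sup>2) powr (1 / p))) +
     (SUP z\<in>{z \<in> \<D>. s < cmod (\<phi> z)}.
        ennreal ((1 - (cmod z)\<^sup>2) * cmod (u z * deriv \<phi> z) / (1 - (cmod (\<phi> z))\<^sup>2) powr ((1 + p) / p))))"
  proof eventually_elim
    case (elim s)
    then show ?case by (intro essential_norm_le_sup[OF u \<phi> p T]) simp_all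
  qed
qed (intro ennreal_tendsto_cmult tendsto_add limsup_boundary_tendsto, simp_all)

section \<open>Assembly of the two equivalences\<close>

lemma comparableI:
  assumes "0 < C" "Y \<le> ennreal C * X" "X \<le> ennreal C * Y"
  shows "comparable C X Y"
proof -
  have "ennreal (inverse C) * Y \<le> ennreal (inverse C) * (ennreal C * X)"
    using assms by (intro mult_left_mono) auto
  also have "\<dots> = ennreal (inverse C * C) * X"
    using assms by (subst ennreal_mult) (auto simp: mult.assoc)
  finally show ?thesis using assms by (simp add: comparable_def)
qed

theorem theorem2p2:
  fixes p :: real
  assumes "1 \<le> p"
  shows "\<exists>C>0. \<forall>u \<phi>.
    u holomorphic_on \<D> \<longrightarrow> \<phi> holomorphic_on \<D> \<longrightarrow> \<phi> ` \<D> \<subseteq> \<D> \<longrightarrow>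
    bounded_operator (Hardy p) (hardy_norm p) Bloch bloch_norm (weighted_comp u \<phi>) \<longrightarrow>
    comparable C
      (essential_norm (Hardy p) (hardy_norm p) Bloch bloch_norm (weighted_comp u \<phi>))
      (max (limsup_boundary (\<lambda>a. a) (\<lambda>a. bloch_norm (weighted_comp u \<phi> (test_p p a))))
           (limsup_boundary (\<lambda>a. a) (\<lambda>a. bloch_norm (weighted_comp u \<phi> (test_q p a))))) \<and>
    comparable C
      (max (limsup_boundary (\<lambda>a. a) (\<lambda>a. bloch_norm (weighted_comp u \<phi> (test_p p a))))
           (limsup_boundary (\<lambda>a. a) (\<lambda>a. bloch_norm (weighted_comp u \<phi> (test_q p a)))))
      (max (limsup_boundary \<phi>
             (\<lambda>z. (1 - (cmod z)\<^sup>2) * cmod (deriv u z) / (1 - (cmod (\<phi> z))\<^sup>2) powr (1 / p)))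
           (limsup_boundary \<phi>
             (\<lambda>z. (1 - (cmod z)\<^sup>2) * cmod (u z * deriv \<phi> z) / (1 - (cmod (\<phi> z))\<^sup>2) powr ((1 + p) / p))))"
proof (intro exI[of _ "8192 * p"] conjI allI impI)
  \<comment> \<open>The inequalities below have constants 16, 512 and 10p, forming a cycle between
    E, max A B and max M1 M2. The composed constants 16 * 512 = 8192 and 512 * 10p = 5120p are both
    at most 8192p.\<close>
  show "0 < 8192 * p" using assms by simp
  fix u \<phi>
  assume u: "u holomorphic_on \<D>" and \<phi>: "\<phi> holomorphic_on \<D>" "\<phi> ` \<D> \<subseteq> \<D>"
    and T: "bounded_operator (Hardy p) (hardy_norm p) Bloch bloch_norm (weighted_comp u \<phi>)"
  have lin: "linear_map (Hardy p) Bloch (weighted_comp u \<phi>)" using T by (simp add: bounded_operator_def)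
  define E where "E = essential_norm (Hardy p) (hardy_norm p) Bloch bloch_norm (weighted_comp u \<phi>)"
  define A where "A = limsup_boundary (\<lambda>a. a) (\<lambda>a. bloch_norm (weighted_comp u \<phi> (test_p p a)))"
  define B where "B = limsup_boundary (\<lambda>a. a) (\<lambda>a. bloch_norm (weighted_comp u \<phi> (test_q p a)))"
  define M1 where "M1 = limsup_boundary \<phi>
    (\<lambda>z. (1 - (cmod z)\<^sup>2) * cmod (deriv u z) / (1 - (cmod (\<phi> z))\<^sup>2) powr (1 / p))"
  define M2 where "M2 = limsup_boundary \<phi>
    (\<lambda>z. (1 - (cmod z)\<^sup>2) * cmod (u z * deriv \<phi> z) / (1 - (cmod (\<phi> z))\<^sup>2) powr ((1 + p) / p))"
  have test_Bloch: "weighted_comp u \<phi> (test_p p a) \<in> Bloch" "weighted_comp u \<phi> (test_q p a) \<in> Bloch"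
    if a: "a \<in> \<D>" for a
  proof -
    have "test_p p a \<in> Hardy p" "test_q p a \<in> Hardy p"
      using test_analytic[OF a] test_hardy_mean[OF a assms] by (auto intro!: HardyI)
    then show "weighted_comp u \<phi> (test_p p a) \<in> Bloch" "weighted_comp u \<phi> (test_q p a) \<in> Bloch"
      using lin by (auto simp: linear_map_def)
  qed
  have "ennreal (1 / 16) * A \<le> E"
    unfolding A_def E_def
    by (rule essential_norm_ge[OF u \<phi> assms lin])
      (auto intro: test_analytic test_hardy_mean[OF _ assms] test_small[OF _ assms])
  moreover have "ennreal (1 / 16) * B \<le> E"
    unfolding B_def E_def
    by (rule essential_norm_ge[OF u \<phi> assms lin])
      (auto intro: test_analytic test_hardy_mean[OF _ assms] test_small[OF _ assms])
  ultimately have "ennreal (1 / 16) * max A B \<le> E" by (auto simp: max_def)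
  then have "ennreal 16 * (ennreal (1 / 16) * max A B) \<le> ennreal 16 * E" by (rule mult_left_mono) simp
  moreover have "ennreal 16 * (ennreal (1 / 16) * max A B) = max A B"
    by (subst mult.assoc[symmetric], subst ennreal_mult[symmetric]) auto
  ultimately have AB: "max A B \<le> ennreal 16 * E" by simp
  have "E \<le> ennreal 256 * (M1 + M2)"
    unfolding E_def M1_def M2_def by (rule essential_norm_le_limsups[OF u \<phi> assms T])
  also have "\<dots> \<le> ennreal 256 * (max M1 M2 + max M1 M2)" by (intro mult_left_mono add_mono) auto
  also have "\<dots> = ennreal 256 * (ennreal 2 * max M1 M2)" by (simp add: mult_2)
  also have "\<dots> = ennreal 512 * max M1 M2"
    by (subst mult.assoc[symmetric], subst ennreal_mult[symmetric]) auto
  finally have EM: "E \<le> ennreal 512 * max M1 M2" .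
  have "max M1 M2 \<le> ennreal (5 * p) * (A + B)"
    unfolding M1_def M2_def A_def B_def by (rule limsup_le_test_limsups[OF u \<phi> assms test_Bloch])
  also have "\<dots> \<le> ennreal (5 * p) * (max A B + max A B)" by (intro mult_left_mono add_mono) auto
  also have "\<dots> = ennreal (5 * p) * (ennreal 2 * max A B)" by (simp add: mult_2)
  also have "\<dots> = ennreal (10 * p) * max A B"
    using assms by (subst mult.assoc[symmetric], subst ennreal_mult[symmetric]) auto
  finally have MAB: "max M1 M2 \<le> ennreal (10 * p) * max A B" .
  have trans: "X \<le> ennreal (8192 * p) * Z"
    if "X \<le> ennreal c * Y" "Y \<le> ennreal d * Z" "0 \<le> c" "0 \<le> d" "c * d \<le> 8192 * p" for X Y Z c d
  proof -
    have "X \<le> ennreal c * (ennreal d * Z)" using that(1) mult_left_mono[OF that(2), of "ennreal c"] by auto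
    also have "\<dots> = ennreal (c * d) * Z"
      using that by (subst mult.assoc[symmetric], subst ennreal_mult[symmetric]) auto
    also have "\<dots> \<le> ennreal (8192 * p) * Z" using that by (intro mult_right_mono ennreal_leI) auto
    finally show ?thesis .
  qed
  have "comparable (8192 * p) E (max A B)"
  proof (rule comparableI)
    show "0 < 8192 * p" using assms by simp
    show "max A B \<le> ennreal (8192 * p) * E" using trans[OF AB, of 1] assms by simp
    show "E \<le> ennreal (8192 * p) * max A B" by (rule trans[OF EM MAB]) (use assms in auto)
  qed
  then show "comparable (8192 * p)
      (essential_norm (Hardy p) (hardy_norm p) Bloch bloch_norm (weighted_comp u \<phi>))
      (max (limsup_boundary (\<lambda>a. a) (\<lambda>a. bloch_norm (weighted_comp u \<phi> (test_p p a))))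
           (limsup_boundary (\<lambda>a. a) (\<lambda>a. bloch_norm (weighted_comp u \<phi> (test_q p a)))))"
    unfolding E_def A_def B_def .
  have "comparable (8192 * p) (max A B) (max M1 M2)"
  proof (rule comparableI)
    show "0 < 8192 * p" using assms by simp
    show "max M1 M2 \<le> ennreal (8192 * p) * max A B" using trans[OF MAB, of 1] assms by simp
    show "max A B \<le> ennreal (8192 * p) * max M1 M2" by (rule trans[OF AB EM]) (use assms in auto)
  qed
  then show "comparable (8192 * p)
      (max (limsup_boundary (\<lambda>a. a) (\<lambda>a. bloch_norm (weighted_comp u \<phi> (test_p p a))))
           (limsup_boundary (\<lambda>a. a) (\<lambda>a. bloch_norm (weighted_comp u \<phi> (test_q p a)))))
      (max (limsup_boundary \<phi>
             (\<lambda>z. (1 - (cmod z)\<^sup>2) * cmod (deriv u z) / (1 - (cmod (\<phi> z))\<^sup>2) powr (1 / p)))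
           (limsup_boundary \<phi>
             (\<lambda>z. (1 - (cmod z)\<^sup>2) * cmod (u z * deriv \<phi> z) / (1 - (cmod (\<phi> z))\<^sup>2) powr ((1 + p) / p))))"
    unfolding A_def B_def M1_def M2_def .
qed

end
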